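(* There exist constants $c_0, c_1 \ge 0$, depending only on the fixed universal machine, such that for every $n$ and all strings $x \in \{0,1\}^n$ and $y \in \{0,1\}^n$ with $C(x \mid n) \geq 13 \log n + I(x:y) + c_0$ and $C(y \mid n) \geq 7 \log n + I(x:y) + c_0$, it holds that \[ C(xy \mid n) \geq C(x \mid n) + C(y \mid x) - \log I(x:y) - c_1\big(C^{(2)}(x \mid n) + C^{(2)}(y \mid n) + C^{(2)}(y \mid x)\big). \]
   Context: $C(u \mid v)$ denotes the plain conditional Kolmogorov complexity of the string $u$ given $v$ with respect to a fixed universal Turing machine; $C(u \mid n)$ means conditioning on (the binary representation of) $n$; $xy$ is the concatenation of $x$ and $y$. For $n$-bit strings $x,y$, $I(x:y) = C(y \mid n) - C(y \mid x)$. Shorthands: $C^{(2)}(x \mid n) = C(C(x\mid n) \mid n)$, $C^{(2)}(y \mid n) = C(C(y\mid n) \mid n)$, and $C^{(2)}(y \mid x) = C(C(y \mid x))$. Logarithms are base 2. *)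

theory Defs
  imports Complex_Main
begin

text \<open>
  Deterministic multi-tape Turing machines over the tape alphabet \<open>{0, 1, blank}\<close> (the blank is
  \<^const>\<open>None\<close>). A tape is a pair of lists: the cells to the left of the head, nearest first, and the
  cells from the head to the right; all cells beyond the two lists are blank.
\<close>

type_synonym symbol = "bool option"
type_synonym tape = "symbol list \<times> symbol list"

datatype move = MoveL | Stay | MoveR

text \<open>
  States are \<open>0, ..., num_states - 1\<close>, with initial state \<open>0\<close>. The machine halts when the transition
  function is undefined. Only the finitely many values of \<open>delta\<close> at a state below \<open>num_states\<close> and a
  symbol list of length \<open>num_tapes\<close> ever matter.
\<close>

record tm =
  num_tapes :: nat
  num_states :: nat
  delta :: "nat \<Rightarrow> symbol list \<Rightarrow> (nat \<times> (symbol \<times> move) list) option"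

definition turing_machine :: "tm \<Rightarrow> bool" where
  "turing_machine M \<longleftrightarrow>
     3 \<le> num_tapes M \<and> 0 < num_states M \<and>
     (\<forall>q s q' acts. q < num_states M \<longrightarrow> length s = num_tapes M \<longrightarrow>
        delta M q s = Some (q', acts) \<longrightarrow>
        q' < num_states M \<and> length acts = num_tapes M)"

definition head_cell :: "symbol list \<Rightarrow> symbol" where
  "head_cell cs = (case cs of [] \<Rightarrow> None | c # _ \<Rightarrow> c)"

definition read_tape :: "tape \<Rightarrow> symbol" where
  "read_tape t = head_cell (snd t)"

fun move_head :: "move \<Rightarrow> tape \<Rightarrow> tape" where
  "move_head MoveL (l, r) = (tl l, head_cell l # r)"
| "move_head Stay (l, r) = (l, r)"
| "move_head MoveR (l, r) = (head_cell r # l, tl r)"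

fun act_tape :: "symbol \<times> move \<Rightarrow> tape \<Rightarrow> tape" where
  "act_tape (s, m) (l, r) = move_head m (l, s # tl r)"

type_synonym config = "nat \<times> tape list"

definition tm_halted :: "tm \<Rightarrow> config \<Rightarrow> bool" where
  "tm_halted M c \<longleftrightarrow> delta M (fst c) (map read_tape (snd c)) = None"

definition tm_step :: "tm \<Rightarrow> config \<Rightarrow> config" where
  "tm_step M c =
     (case delta M (fst c) (map read_tape (snd c)) of
        None \<Rightarrow> c
      | Some (q', acts) \<Rightarrow> (q', map2 act_tape acts (snd c)))"

text \<open>
  Tape 0 initially holds the program, tape 1 the condition; tape 2 is the output tape and the
  remaining ones are work tapes. The output is the maximal block of non-blank cells extending
  from the head of tape 2 to the right.
\<close>

definition tm_init :: "tm \<Rightarrow> bool list \<Rightarrow> bool list \<Rightarrow> config" where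
  "tm_init M p v =
     (0, [([], map Some p), ([], map Some v)] @ replicate (num_tapes M - 2) ([], []))"

definition tm_output :: "config \<Rightarrow> bool list" where
  "tm_output c = map the (takeWhile (\<lambda>s. s \<noteq> None) (snd (snd c ! 2)))"

definition tm_computes :: "tm \<Rightarrow> bool list \<Rightarrow> bool list \<Rightarrow> bool list \<Rightarrow> bool" where
  "tm_computes M p v u \<longleftrightarrow>
     (\<exists>t. tm_halted M ((tm_step M ^^ t) (tm_init M p v)) \<and>
          tm_output ((tm_step M ^^ t) (tm_init M p v)) = u)"

text \<open>
  Universality in the sense of the invariance theorem: every machine is simulated, for each
  condition, with programs that are longer by at most a constant.
\<close>

definition universal_tm :: "tm \<Rightarrow> bool" where
  "universal_tm U \<longleftrightarrow>
     turing_machine U \<and>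
     (\<forall>M. turing_machine M \<longrightarrow>
        (\<exists>c. \<forall>p v u. tm_computes M p v u \<longrightarrow>
           (\<exists>p'. length p' \<le> length p + c \<and> tm_computes U p' v u)))"

text \<open>
  For universal \<open>U\<close> every string has a program under every condition, so the minimum exists.
\<close>

definition Kcond :: "tm \<Rightarrow> bool list \<Rightarrow> bool list \<Rightarrow> nat" where
  "Kcond U u v = (LEAST k. \<exists>p. length p = k \<and> tm_computes U p v u)"

text \<open>Binary representation, most significant bit first, without leading zeros; \<open>0\<close> is \<open>[False]\<close>.\<close>

fun bin_rep :: "nat \<Rightarrow> bool list" where
  "bin_rep n = (if n < 2 then [n = 1] else bin_rep (n div 2) @ [odd n])"

declare bin_rep.simps [simp del]

definition Kcond_nat :: "tm \<Rightarrow> bool list \<Rightarrow> nat \<Rightarrow> nat" where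
  "Kcond_nat U u n = Kcond U u (bin_rep n)"

definition K2_nat :: "tm \<Rightarrow> bool list \<Rightarrow> nat \<Rightarrow> nat" where
  "K2_nat U u n = Kcond_nat U (bin_rep (Kcond_nat U u n)) n"

text \<open>The outer complexity here is unconditional, that is, the condition is the empty string.\<close>

definition K2 :: "tm \<Rightarrow> bool list \<Rightarrow> bool list \<Rightarrow> nat" where
  "K2 U u v = Kcond U (bin_rep (Kcond U u v)) []"

text \<open>Meant for strings of equal length; the value can be negative.\<close>

definition mutual_info :: "tm \<Rightarrow> bool list \<Rightarrow> bool list \<Rightarrow> int" where
  "mutual_info U x y = int (Kcond_nat U y (length x)) - int (Kcond U y x)"

text \<open>
  The base-2 logarithm of an information quantity, which need not be positive:
  arguments below 1 are read as 1, so that the logarithm is 0 there.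
\<close>

definition log_info :: "int \<Rightarrow> real" where
  "log_info i = log 2 (real_of_int (max 1 i))"

end

(*
  Let k = C(x|n), l = C(y|x), t = C(xy|n), and let s be the total length of shortest programs for
  (the binary representations of) k given n and of l. For a natural number h with
  T = k + l - 4h > t, the set B of the strings with a program shorter than T has fewer than 2^T
  elements, contains xy, and can be enumerated from n, h and the two programs.
  If the section of B at x has about 2^m elements, then y is determined by x, h, the two programs
  and an index of m bits in the enumeration of this section, so l <= m + h + 2s + O(1). On the other
  hand, at most 2^(T-m) strings have such a large section, so x is determined by n, h, the two
  programs and T - m further bits, so k <= T - m + h + 2s + O(1). Adding up, 2h <= 4s + O(1), which
  bounds k + l - t by O(s + 1). The factor 4 in T outweighs the cost 2h of transmitting h in unary
  twice.
  The second hypothesis forces C(y|x) >= c_0, and for suitable c_0 this excludes that C(y|x) is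
  printed by the empty program. So s > 0, which absorbs the additive constant.

  Both enumerations are a single unbounded search over a predicate built from pairing, iteration and
  bounded quantifiers on natural numbers; unary register programs on tapes realize such a search.
*)
theory Submission
  imports Defs "HOL-Library.Nat_Bijection"
begin

text \<open>The error has to be linear in the second-order complexities, so the decoders cannot
  receive k, l or T in binary, at a cost of order log n. They run the two shortest programs to learn
  k and l, and only the defect h is spelled out. The program for k expects n, which both decoders
  know, one of them as the length of x; the program for l runs without a condition and so serves
  both. The exponent m costs nothing extra either: a decoder reads the number r of index bits off
  the length of the index, and recovers m as T - r where it is needed. The obstacle is that
  universality speaks of concrete multi-tape machines, so every decoder has to be turned into one.
  Only the length of programs counts, never their running time, which permits unary registers and
  brute force. All decoders follow one template: find the least e with D(p, v, e) and print g(p, v,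
  e).\<close>

section \<open>A structured language for Turing machines\<close>

text \<open>A list with its implicit blanks, which makes tapes that differ by trailing blanks equal.\<close>

definition cell :: "symbol list \<Rightarrow> nat \<Rightarrow> symbol" where
  "cell xs i = (if i < length xs then xs ! i else None)"

type_synonym atape = "(nat \<Rightarrow> symbol) \<times> (nat \<Rightarrow> symbol)"

fun abs_tape :: "tape \<Rightarrow> atape" where
  "abs_tape (l, r) = (cell l, cell r)"

fun aact :: "symbol \<times> move \<Rightarrow> atape \<Rightarrow> atape" where
  "aact (s, MoveL) (L, R) = (\<lambda>i. L (Suc i), case_nat (L 0) (R(0 := s)))"
| "aact (s, Stay) (L, R) = (L, R(0 := s))"
| "aact (s, MoveR) (L, R) = (case_nat s L, \<lambda>i. R (Suc i))"

lemma cell_Nil [simp]: "cell [] = (\<lambda>_. None)"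
  by (auto simp: cell_def)

lemma cell_Cons: "cell (s # xs) = case_nat s (cell xs)"
  by (auto simp: cell_def fun_eq_iff split: nat.splits)

lemma cell_tl: "cell (tl xs) = (\<lambda>i. cell xs (Suc i))"
  by (cases xs) (auto simp: cell_Cons)

lemma head_cell_eq: "head_cell xs = cell xs 0"
  by (cases xs) (auto simp: cell_Cons head_cell_def)

lemma case_nat_upd: "case_nat s f = (g(0 := s))" if "\<And>i. f i = g (Suc i)"
  using that by (auto simp: fun_eq_iff split: nat.splits)

text \<open>List tapes are not canonical, since writing a blank or moving past an end can leave
  explicit blanks behind. This commutation allows all later reasoning to take place on
  functions.\<close>

lemma abs_act_tape: "abs_tape (act_tape a t) = aact a (abs_tape t)"
proof -
  obtain s m l r where "a = (s, m)" "t = (l, r)" by (metis surj_pair)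
  moreover have "cell (s # tl r) = (cell r)(0 := s)"
    by (simp add: cell_Cons cell_tl case_nat_upd)
  moreover have "cell (tl (s # tl r)) = (\<lambda>i. cell r (Suc i))"
    by (simp add: cell_tl)
  ultimately show ?thesis
    by (cases m) (simp_all add: cell_Cons head_cell_eq cell_tl)
qed

lemma read_tape_abs: "read_tape t = snd (abs_tape t) 0"
  by (cases t) (simp add: read_tape_def head_cell_eq)

text \<open>A machine step acts on every tape; an idle tape rewrites the symbol under its
  head.\<close>

lemma aact_read_Stay [simp]: "aact (snd T 0, Stay) T = T"
  by (cases T) simp

section \<open>While-programs over tapes and their big-step semantics\<close>

datatype com =
    Act nat "symbol \<Rightarrow> symbol \<times> move"
  | Seq com com
  | Cond nat "symbol \<Rightarrow> bool" com com
  | While nat "symbol \<Rightarrow> bool" com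

type_synonym store = "nat \<Rightarrow> atape"

inductive exec :: "com \<Rightarrow> store \<Rightarrow> store \<Rightarrow> bool" where
  exec_Act: "exec (Act i f) S (S(i := aact (f (snd (S i) 0)) (S i)))"
| exec_Seq: "exec a S S' \<Longrightarrow> exec b S' S'' \<Longrightarrow> exec (Seq a b) S S''"
| exec_Cond: "exec (if P (snd (S i) 0) then a else b) S S' \<Longrightarrow> exec (Cond i P a b) S S'"
| exec_While_False: "\<not> P (snd (S i) 0) \<Longrightarrow> exec (While i P a) S S"
| exec_While_True: "P (snd (S i) 0) \<Longrightarrow> exec a S S' \<Longrightarrow> exec (While i P a) S' S'' \<Longrightarrow>
    exec (While i P a) S S''"

text \<open>The control state of the compiled machine is the list of commands still to be executed.\<close>

abbreviation nop :: "(nat \<Rightarrow> symbol) \<Rightarrow> nat \<Rightarrow> symbol \<times> move" where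
  "nop s \<equiv> (\<lambda>i. (s i, Stay))"

fun cnext :: "com list \<Rightarrow> (nat \<Rightarrow> symbol) \<Rightarrow> (com list \<times> (nat \<Rightarrow> symbol \<times> move)) option" where
  "cnext [] s = None"
| "cnext (Act i f # K) s = Some (K, (nop s)(i := f (s i)))"
| "cnext (Seq a b # K) s = Some (a # b # K, nop s)"
| "cnext (Cond i P a b # K) s = Some ((if P (s i) then a else b) # K, nop s)"
| "cnext (While i P a # K) s = Some (if P (s i) then a # While i P a # K else K, nop s)"

definition cstep :: "com list \<times> store \<Rightarrow> com list \<times> store" where
  "cstep = (\<lambda>(K, S). case cnext K (\<lambda>i. snd (S i) 0) of
     None \<Rightarrow> (K, S)
   | Some (K', a) \<Rightarrow> (K', \<lambda>i. aact (a i) (S i)))"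

lemma cstep_compose:
  "(cstep ^^ t) c = c' \<Longrightarrow> (cstep ^^ t') c' = c'' \<Longrightarrow> (cstep ^^ (t' + t)) c = c''"
  by (simp add: funpow_add)

text \<open>The continuation \<open>K\<close> is arbitrary so that the parts of a sequence or loop
  compose: each partial run ends exactly when its own continuation is exposed again.\<close>

lemma exec_cstep: "exec c S S' \<Longrightarrow> \<exists>t. (cstep ^^ t) (c # K, S) = (K, S')"
proof (induction arbitrary: K rule: exec.induct)
  case (exec_Act i f S)
  have "cstep (Act i f # K, S) = (K, S(i := aact (f (snd (S i) 0)) (S i)))"
    by (auto simp: cstep_def fun_eq_iff)
  then have "(cstep ^^ 1) (Act i f # K, S) = (K, S(i := aact (f (snd (S i) 0)) (S i)))"
    by (simp only: One_nat_def funpow.simps o_apply id_apply)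
  then show ?case by blast
next
  case (exec_Seq a S S' b S'')
  obtain t where t: "(cstep ^^ t) (a # b # K, S) = (b # K, S')" using exec_Seq.IH(1) by blast
  obtain t' where t': "(cstep ^^ t') (b # K, S') = (K, S'')" using exec_Seq.IH(2) by blast
  have "(cstep ^^ 1) (Seq a b # K, S) = (a # b # K, S)" by (simp add: cstep_def)
  from cstep_compose[OF cstep_compose[OF this t] t'] show ?case by blast
next
  case (exec_Cond P S i a b S')
  obtain t where t: "(cstep ^^ t) ((if P (snd (S i) 0) then a else b) # K, S) = (K, S')"
    using exec_Cond.IH by blast
  have "(cstep ^^ 1) (Cond i P a b # K, S) = ((if P (snd (S i) 0) then a else b) # K, S)"
    by (simp add: cstep_def)
  from cstep_compose[OF this t] show ?case by blast
next
  case (exec_While_False P S i a)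
  then have "cstep (While i P a # K, S) = (K, S)" by (simp add: cstep_def)
  then show ?case by (intro exI[of _ 1]) simp
next
  case (exec_While_True P S i a S' S'')
  obtain t where t: "(cstep ^^ t) (a # While i P a # K, S) = (While i P a # K, S')"
    using exec_While_True.IH(1) by blast
  obtain t' where t': "(cstep ^^ t') (While i P a # K, S') = (K, S'')"
    using exec_While_True.IH(2) by blast
  have "(cstep ^^ 1) (While i P a # K, S) = (a # While i P a # K, S)"
    using exec_While_True.hyps by (simp add: cstep_def)
  from cstep_compose[OF cstep_compose[OF this t] t'] show ?case by blast
qed

section \<open>Finitely many control states and finitely many tapes\<close>

fun width :: "com \<Rightarrow> nat" where
  "width (Act i f) = Suc i"
| "width (Seq a b) = max (width a) (width b)"
| "width (Cond i P a b) = max (Suc i) (max (width a) (width b))"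
| "width (While i P a) = max (Suc i) (width a)"

text \<open>The continuations that can occur while the command runs in front of \<open>K\<close>,
  before \<open>K\<close> itself is reached. A loop body returns to the same loop and not to a new
  continuation, which keeps the set finite.\<close>

fun conts :: "com \<Rightarrow> com list \<Rightarrow> com list set" where
  "conts (Act i f) K = {Act i f # K}"
| "conts (Seq a b) K = insert (Seq a b # K) (conts a (b # K) \<union> conts b K)"
| "conts (Cond i P a b) K = insert (Cond i P a b # K) (conts a K \<union> conts b K)"
| "conts (While i P a) K = insert (While i P a # K) (conts a (While i P a # K))"

lemma finite_conts: "finite (conts c K)"
  by (induction c arbitrary: K) auto

lemma conts_start: "c # K \<in> conts c K"
  by (cases c) auto

text \<open>Closure under \<open>cnext\<close>, up to the exit \<open>K\<close>, makes the finite
  set a legitimate state space, and idleness beyond the width makes \<open>N\<close> tapes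
  enough.\<close>

lemma conts_cnext:
  "k \<in> conts c K \<Longrightarrow> width c \<le> N \<Longrightarrow> cnext k s = Some (k', a) \<Longrightarrow>
    k' \<in> insert K (conts c K) \<and> (\<forall>i\<ge>N. a i = (s i, Stay))"
proof (induction c arbitrary: K)
  case (Act i f)
  then show ?case by auto
next
  case (Seq c1 c2)
  consider "k = Seq c1 c2 # K" | "k \<in> conts c1 (c2 # K)" | "k \<in> conts c2 K"
    using Seq.prems(1) by auto
  then show ?case
  proof cases
    case 1
    then show ?thesis using Seq.prems conts_start by auto
  next
    case 2
    then show ?thesis using Seq.IH(1)[OF 2] Seq.prems conts_start by auto
  next
    case 3
    then show ?thesis using Seq.IH(2)[OF 3] Seq.prems by auto
  qed
next
  case (Cond i P c1 c2)
  then show ?case using conts_start by (auto split: if_splits)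
next
  case (While i P c)
  then show ?case using conts_start by (auto split: if_splits)
qed

text \<open>A list of states may repeat entries, so any matching position serves; correctness is
  always stated through \<open>ks ! q\<close>, not through the number \<open>q\<close>.\<close>

definition index_of :: "'a list \<Rightarrow> 'a \<Rightarrow> nat" where
  "index_of xs x = (SOME i. i < length xs \<and> xs ! i = x)"

lemma index_of: "x \<in> set xs \<Longrightarrow> index_of xs x < length xs \<and> xs ! index_of xs x = x"
  unfolding index_of_def by (rule someI_ex) (simp add: in_set_conv_nth)

definition machine :: "com list list \<Rightarrow> nat \<Rightarrow> tm" where
  "machine ks N = \<lparr>num_tapes = N, num_states = length ks,
     delta = (\<lambda>q s. case cnext (ks ! q) (\<lambda>i. if i < N then s ! i else None) of
        None \<Rightarrow> None
      | Some (k, a) \<Rightarrow> Some (index_of ks k, map a [0..<N]))\<rparr>"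

definition abs_store :: "tape list \<Rightarrow> store" where
  "abs_store ts i = (if i < length ts then abs_tape (ts ! i) else (\<lambda>_. None, \<lambda>_. None))"

lemma machine_steps:
  assumes closed: "\<And>k s k' a. k \<in> set ks \<Longrightarrow> cnext k s = Some (k', a) \<Longrightarrow>
      k' \<in> set ks \<and> (\<forall>i\<ge>N. a i = (s i, Stay))"
    and "q < length ks" "length ts = N"
  shows "\<exists>q' ts'. (tm_step (machine ks N) ^^ t) (q, ts) = (q', ts') \<and> q' < length ks \<and>
      length ts' = N \<and> (cstep ^^ t) (ks ! q, abs_store ts) = (ks ! q', abs_store ts')"
proof (induction t)
  case 0
  then show ?case using assms by simp
next
  case (Suc t)
  then obtain q' ts' where IH: "(tm_step (machine ks N) ^^ t) (q, ts) = (q', ts')"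
    "q' < length ks" "length ts' = N"
    "(cstep ^^ t) (ks ! q, abs_store ts) = (ks ! q', abs_store ts')" by blast
  define s where "s = (\<lambda>i. snd (abs_store ts' i) 0)"
  have s: "(\<lambda>i. if i < N then map read_tape ts' ! i else None) = s"
    using IH(3) by (auto simp: s_def abs_store_def read_tape_abs fun_eq_iff)
  show ?case
  proof (cases "cnext (ks ! q') s")
    case None
    then have "tm_step (machine ks N) (q', ts') = (q', ts')"
      by (simp add: tm_step_def machine_def s)
    moreover have "cstep (ks ! q', abs_store ts') = (ks ! q', abs_store ts')"
      using None by (simp add: cstep_def s_def)
    ultimately show ?thesis using IH by simp
  next
    case (Some ka)
    obtain k a where ka: "cnext (ks ! q') s = Some (k, a)" using Some by (cases ka) auto
    have c: "k \<in> set ks" "\<And>i. i \<ge> N \<Longrightarrow> a i = (s i, Stay)"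
      using closed[OF nth_mem[OF IH(2)] ka] by auto
    define ts'' where "ts'' = map2 act_tape (map a [0..<N]) ts'"
    have "tm_step (machine ks N) (q', ts') = (index_of ks k, ts'')"
      using ka by (simp add: tm_step_def machine_def s ts''_def)
    moreover have "(\<lambda>i. aact (a i) (abs_store ts' i)) = abs_store ts''"
      using c(2) IH(3) by (auto simp: fun_eq_iff abs_store_def ts''_def abs_act_tape s_def)
    then have "cstep (ks ! q', abs_store ts') = (k, abs_store ts'')"
      using ka by (simp add: cstep_def s_def)
    moreover have "length ts'' = N" using IH(3) by (simp add: ts''_def)
    ultimately show ?thesis using IH index_of[OF c(1)] by auto
  qed
qed

definition init_store :: "bool list \<Rightarrow> bool list \<Rightarrow> store" where
  "init_store p v = (\<lambda>i. (\<lambda>_. None, cell (if i = 0 then map Some p else if i = 1 then map Some v else [])))"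

lemma takeWhile_cell:
  assumes "cell r = cell (map Some w)"
  shows "map the (takeWhile (\<lambda>s. s \<noteq> None) r) = w"
  using assms
proof (induction w arbitrary: r)
  case Nil
  then show ?case by (cases r) (auto simp: cell_Cons fun_eq_iff split: nat.splits dest: spec[of _ 0])
next
  case (Cons b w)
  then obtain s r' where r: "r = s # r'"
    by (cases r) (auto simp: cell_Cons fun_eq_iff split: nat.splits dest: spec[of _ 0])
  have "s = Some b" using fun_cong[OF Cons.prems, of 0] by (simp add: r cell_Cons)
  moreover have "cell r' = cell (map Some w)"
    using fun_cong[OF Cons.prems, of "Suc i" for i] by (auto simp: r cell_Cons)
  ultimately show ?case using Cons.IH r by simp
qed

theorem compile_com:
  "\<exists>M. turing_machine M \<and>
     (\<forall>p v w S. exec c (init_store p v) S \<longrightarrow> snd (S 2) = cell (map Some w) \<longrightarrow> tm_computes M p v w)"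
proof -
  obtain xs where xs: "set xs = insert [] (conts c [])"
    using finite_list[of "insert [] (conts c [])"] finite_conts by auto
  \<comment> \<open>The initial state must have number 0, so \<open>[c]\<close> is put in front
    although it occurs in \<open>xs\<close> as well.\<close>
  define ks where "ks = [c] # xs"
  define N where "N = max 3 (width c)"
  define M where "M = machine ks N"
  have ks: "set ks = insert [] (conts c [])"
    using xs conts_start[of c "[]"] by (auto simp: ks_def)
  have closed: "k' \<in> set ks \<and> (\<forall>i\<ge>N. a i = (s i, Stay))"
    if "k \<in> set ks" "cnext k s = Some (k', a)" for k s k' a
    using conts_cnext[of k c "[]" N s k' a] that by (auto simp: ks N_def)
  have "turing_machine M"
    unfolding turing_machine_def
  proof (intro conjI allI impI)
    show "3 \<le> num_tapes M" "0 < num_states M" by (simp_all add: M_def machine_def N_def ks_def)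
    fix q s q' acts
    assume q: "q < num_states M" and s: "length s = num_tapes M" and d: "delta M q s = Some (q', acts)"
    obtain k a where ka: "cnext (ks ! q) (\<lambda>i. if i < N then s ! i else None) = Some (k, a)"
      "q' = index_of ks k" "acts = map a [0..<N]"
      using d by (auto simp: M_def machine_def split: option.splits)
    have "k \<in> set ks" using closed[OF _ ka(1)] q by (simp add: M_def machine_def)
    then show "q' < num_states M" "length acts = num_tapes M"
      using ka index_of[of k ks] by (simp_all add: M_def machine_def)
  qed
  moreover have "tm_computes M p v w"
    if run: "exec c (init_store p v) S" and S: "snd (S 2) = cell (map Some w)" for p v w S
  proof -
    define ts where "ts = [([], map Some p), ([], map Some v)] @ replicate (N - 2) ([] :: symbol list, [] :: symbol list)"
    have init: "tm_init M p v = (0, ts)" by (simp add: tm_init_def M_def machine_def ts_def)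
    have len: "length ts = N" by (simp add: ts_def N_def)
    have "abs_store ts i = init_store p v i" for i
      by (cases "i < N") (auto simp: abs_store_def init_store_def ts_def nth_append nth_Cons split: nat.splits)
    then have st: "abs_store ts = init_store p v" by auto
    obtain t where t: "(cstep ^^ t) ([c], init_store p v) = ([], S)"
      using exec_cstep[OF run] by blast
    have l0: "0 < length ks" by (simp add: ks_def)
    obtain q' ts' where q': "(tm_step M ^^ t) (0, ts) = (q', ts')" "q' < length ks"
      "length ts' = N" "(cstep ^^ t) (ks ! 0, abs_store ts) = (ks ! q', abs_store ts')"
      using machine_steps[of ks N 0 ts t] closed l0 len unfolding M_def by blast
    have e: "ks ! q' = []" "S = abs_store ts'" using q'(4) t st by (auto simp: ks_def)
    have "tm_halted M (q', ts')" by (simp add: tm_halted_def M_def machine_def e)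
    moreover have "cell (snd (ts' ! 2)) = cell (map Some w)"
      using S e(2) q'(3) by (cases "ts' ! 2") (auto simp: abs_store_def N_def less_max_iff_disj)
    then have "tm_output (q', ts') = w"
      using takeWhile_cell[of "snd (ts' ! 2)" w] by (simp add: tm_output_def)
    ultimately show ?thesis unfolding tm_computes_def init by (intro exI[of _ t]) (simp only: q'(1))
  qed
  ultimately show ?thesis by blast
qed

section \<open>Registers in unary\<close>

definition stk :: "(nat \<Rightarrow> bool list) \<Rightarrow> store" where
  "stk w = (\<lambda>i. (\<lambda>_. None, cell (map Some (w i))))"

definition run :: "com \<Rightarrow> (nat \<Rightarrow> bool list) \<Rightarrow> (nat \<Rightarrow> bool list) \<Rightarrow> bool" where
  "run c w w' \<longleftrightarrow> exec c (stk w) (stk w')"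

lemma init_store_stk: "init_store p v = stk (\<lambda>i. if i = 0 then p else if i = 1 then v else [])"
  by (auto simp: init_store_def stk_def)

text \<open>Erasing the cell before leaving it keeps everything to the left of the head blank, as
  \<open>stk\<close> demands.\<close>

definition pop :: "nat \<Rightarrow> com" where
  "pop i = Act i (\<lambda>_. (None, MoveR))"

definition push :: "nat \<Rightarrow> bool \<Rightarrow> com" where
  "push i b = Seq (Act i (\<lambda>s. (s, MoveL))) (Act i (\<lambda>_. (Some b, Stay)))"

lemma stk_upd: "(stk w)(i := (\<lambda>_. None, cell (map Some x))) = stk (w(i := x))"
  by (auto simp: stk_def)

lemma run_pop: "run (pop i) w (w(i := tl (w i)))"
proof -
  have "aact (None, MoveR) (stk w i) = (\<lambda>_. None, cell (map Some (tl (w i))))"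
    by (auto simp: stk_def cell_tl map_tl fun_eq_iff split: nat.splits)
  then show ?thesis
    using exec_Act[of i "\<lambda>_. (None, MoveR)" "stk w"] by (simp add: run_def pop_def stk_upd)
qed

lemma run_push: "run (push i b) w (w(i := b # w i))"
proof -
  let ?S = "(stk w)(i := (\<lambda>_. None, cell (None # map Some (w i))))"
  have "aact (snd (stk w i) 0, MoveL) (stk w i) = (\<lambda>_. None, cell (None # map Some (w i)))"
    by (auto simp: stk_def cell_Cons)
  then have 1: "exec (Act i (\<lambda>s. (s, MoveL))) (stk w) ?S"
    using exec_Act[of i "\<lambda>s. (s, MoveL)" "stk w"] by simp
  have "aact (Some b, Stay) (?S i) = (\<lambda>_. None, cell (map Some (b # w i)))"
    by (auto simp: cell_Cons fun_eq_iff split: nat.splits)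
  then have 2: "exec (Act i (\<lambda>_. (Some b, Stay))) ?S (stk (w(i := b # w i)))"
    using exec_Act[of i "\<lambda>_. (Some b, Stay)" ?S] by (simp only: fun_upd_upd stk_upd)
  show ?thesis unfolding run_def push_def by (rule exec_Seq[OF 1 2])
qed

lemma run_Seq: "run a w w' \<Longrightarrow> run b w' w'' \<Longrightarrow> run (Seq a b) w w''"
  unfolding run_def by (rule exec_Seq)

lemma stk_head: "snd (stk w i) 0 = (case w i of [] \<Rightarrow> None | b # _ \<Rightarrow> Some b)"
  by (auto simp: stk_def cell_Cons split: list.splits)

lemma run_Cond:
  "run (if P (case w i of [] \<Rightarrow> None | b # _ \<Rightarrow> Some b) then a else b) w w' \<Longrightarrow> run (Cond i P a b) w w'"
  unfolding run_def by (rule exec_Cond) (simp add: stk_head)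

abbreviation while_stk :: "nat \<Rightarrow> com \<Rightarrow> com" where
  "while_stk i c \<equiv> While i (\<lambda>s. s \<noteq> None) c"

lemma run_while_Nil: "w i = [] \<Longrightarrow> run (while_stk i c) w w"
  unfolding run_def by (rule exec_While_False) (simp add: stk_head)

lemma run_while_Cons:
  "w i \<noteq> [] \<Longrightarrow> run c w w' \<Longrightarrow> run (while_stk i c) w' w'' \<Longrightarrow> run (while_stk i c) w w''"
  unfolding run_def by (rule exec_While_True) (auto simp: stk_head split: list.splits)

text \<open>The tapes below \<open>a\<close> form a frame with arbitrary contents; register
  \<open>i\<close> is kept in unary on tape \<open>a + i\<close>. Quantifying over the frame in
  \<open>rex\<close> says that a program leaves it unchanged.\<close>

definition regs :: "(nat \<Rightarrow> bool list) \<Rightarrow> nat \<Rightarrow> (nat \<Rightarrow> nat) \<Rightarrow> nat \<Rightarrow> bool list" where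
  "regs w a e = (\<lambda>j. if j < a then w j else replicate (e (j - a)) True)"

definition rex :: "nat \<Rightarrow> com \<Rightarrow> (nat \<Rightarrow> nat) \<Rightarrow> (nat \<Rightarrow> nat) \<Rightarrow> bool" where
  "rex a c e e' \<longleftrightarrow> (\<forall>w. run c (regs w a e) (regs w a e'))"

definition inc :: "nat \<Rightarrow> nat \<Rightarrow> com" where "inc a i = push (a + i) True"
definition dec :: "nat \<Rightarrow> nat \<Rightarrow> com" where "dec a i = pop (a + i)"
definition wh :: "nat \<Rightarrow> nat \<Rightarrow> com \<Rightarrow> com" where "wh a i c = while_stk (a + i) c"
definition ifz :: "nat \<Rightarrow> nat \<Rightarrow> com \<Rightarrow> com \<Rightarrow> com" where
  "ifz a i c d = Cond (a + i) (\<lambda>s. s = None) c d"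

lemma rex_inc: "rex a (inc a i) e (e(i := Suc (e i)))"
proof -
  have "(regs w a e)(a + i := True # regs w a e (a + i)) = regs w a (e(i := Suc (e i)))" for w
    by (auto simp: regs_def fun_eq_iff)
  then show ?thesis unfolding rex_def inc_def using run_push by metis
qed

lemma rex_dec: "rex a (dec a i) e (e(i := e i - 1))"
proof -
  have "(regs w a e)(a + i := tl (regs w a e (a + i))) = regs w a (e(i := e i - 1))" for w
    by (auto simp: regs_def fun_eq_iff)
  then show ?thesis unfolding rex_def dec_def using run_pop by metis
qed

lemma rex_Seq: "rex a c e e' \<Longrightarrow> rex a d e' e'' \<Longrightarrow> rex a (Seq c d) e e''"
  unfolding rex_def using run_Seq by blast

lemma regs_Nil: "regs w a e (a + i) = [] \<longleftrightarrow> e i = 0"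
  by (simp add: regs_def)

lemma rex_wh_0: "e i = 0 \<Longrightarrow> rex a (wh a i c) e e"
  unfolding rex_def wh_def using run_while_Nil regs_Nil by blast

lemma rex_wh_Suc:
  "e i \<noteq> 0 \<Longrightarrow> rex a c e e' \<Longrightarrow> rex a (wh a i c) e' e'' \<Longrightarrow> rex a (wh a i c) e e''"
  unfolding rex_def wh_def using run_while_Cons regs_Nil by metis

lemma rex_ifz: "rex a (if e i = 0 then c else d) e e' \<Longrightarrow> rex a (ifz a i c d) e e'"
  unfolding rex_def ifz_def
  by (intro allI run_Cond) (auto simp: regs_def split: list.splits if_splits)

lemma rex_eq: "rex a c e e' \<Longrightarrow> e' = e'' \<Longrightarrow> rex a c e e''"
  by simp

definition mv :: "nat \<Rightarrow> nat \<Rightarrow> nat \<Rightarrow> com" where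
  "mv a i j = wh a i (Seq (dec a i) (inc a j))"

lemma rex_mv:
  assumes "i \<noteq> j"
  shows "rex a (mv a i j) e (e(i := 0, j := e j + e i))"
proof -
  have "e i = k \<Longrightarrow> rex a (mv a i j) e (e(i := 0, j := e j + k))" for k
  proof (induction k arbitrary: e)
    case 0
    then show ?case using rex_wh_0[of e i a] by (auto simp: mv_def intro!: rex_eq[OF rex_wh_0])
  next
    case (Suc k)
    let ?e = "e(i := k, j := Suc (e j))"
    have 1: "rex a (Seq (dec a i) (inc a j)) e ?e"
      by (rule rex_eq[OF rex_Seq[OF rex_dec rex_inc]]) (use assms Suc.prems in \<open>auto simp: fun_eq_iff\<close>)
    have "?e i = k" using assms by simp
    from Suc.IH[of ?e, OF this] have "rex a (mv a i j) ?e (?e(i := 0, j := ?e j + k))" .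
    from rex_wh_Suc[OF _ 1 this[unfolded mv_def]] Suc.prems
    have "rex a (mv a i j) e (?e(i := 0, j := ?e j + k))" by (simp add: mv_def)
    then show ?case by (rule rex_eq) (use assms in \<open>auto simp: fun_eq_iff\<close>)
  qed
  then show ?thesis by blast
qed

definition clr :: "nat \<Rightarrow> nat \<Rightarrow> com" where
  "clr a i = wh a i (dec a i)"

lemma rex_clr: "rex a (clr a i) e (e(i := 0))"
proof -
  have "e i = k \<Longrightarrow> rex a (clr a i) e (e(i := 0))" for k
  proof (induction k arbitrary: e)
    case 0
    then show ?case by (auto simp: clr_def intro!: rex_eq[OF rex_wh_0])
  next
    case (Suc k)
    let ?e = "e(i := k)"
    have 1: "rex a (dec a i) e ?e" by (rule rex_eq[OF rex_dec]) (simp add: Suc.prems)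
    have "rex a (clr a i) ?e (?e(i := 0))" by (rule Suc.IH) simp
    from rex_wh_Suc[OF _ 1 this[unfolded clr_def]] Suc.prems
    have "rex a (clr a i) e (?e(i := 0))" by (simp only: clr_def)
    then show ?case by (rule rex_eq) auto
  qed
  then show ?thesis by blast
qed

definition Z :: "nat \<Rightarrow> nat" where "Z = (\<lambda>_. 0)"

lemma Z_apply [simp]: "Z i = 0"
  by (simp add: Z_def)

definition mv2 :: "nat \<Rightarrow> nat \<Rightarrow> nat \<Rightarrow> nat \<Rightarrow> com" where
  "mv2 a i j k = wh a i (Seq (dec a i) (Seq (inc a j) (inc a k)))"

lemma rex_mv2:
  assumes "i \<noteq> j" "i \<noteq> k" "j \<noteq> k"
  shows "rex a (mv2 a i j k) e (e(i := 0, j := e j + e i, k := e k + e i))"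
proof -
  have "e i = n \<Longrightarrow> rex a (mv2 a i j k) e (e(i := 0, j := e j + n, k := e k + n))" for n
  proof (induction n arbitrary: e)
    case 0
    then show ?case by (auto simp: mv2_def intro!: rex_eq[OF rex_wh_0])
  next
    case (Suc n)
    let ?e = "e(i := n, j := Suc (e j), k := Suc (e k))"
    have 1: "rex a (Seq (dec a i) (Seq (inc a j) (inc a k))) e ?e"
      by (rule rex_eq[OF rex_Seq[OF rex_dec rex_Seq[OF rex_inc rex_inc]]])
        (use assms Suc.prems in \<open>auto simp: fun_eq_iff\<close>)
    have "?e i = n" using assms by simp
    from Suc.IH[of ?e, OF this]
    have "rex a (mv2 a i j k) ?e (?e(i := 0, j := ?e j + n, k := ?e k + n))" .
    from rex_wh_Suc[OF _ 1 this[unfolded mv2_def]] Suc.prems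
    have "rex a (mv2 a i j k) e (?e(i := 0, j := ?e j + n, k := ?e k + n))" by (simp add: mv2_def)
    then show ?case by (rule rex_eq) (use assms in \<open>auto simp: fun_eq_iff\<close>)
  qed
  then show ?thesis by blast
qed

definition dup :: "nat \<Rightarrow> com" where
  "dup a = Seq (mv2 a 0 1 2) (mv a 2 0)"

lemma rex_dup: "rex a (dup a) (Z(0 := x)) (Z(0 := x, 1 := x))"
  unfolding dup_def
  by (rule rex_eq[OF rex_Seq[OF rex_mv2 rex_mv]]) (auto simp: fun_eq_iff)

definition swap :: "nat \<Rightarrow> com" where
  "swap a = Seq (mv a 0 2) (Seq (mv a 1 0) (mv a 2 1))"

lemma rex_swap: "rex a (swap a) (Z(0 := x, 1 := y)) (Z(0 := y, 1 := x))"
  unfolding swap_def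
  by (rule rex_eq[OF rex_Seq[OF rex_mv rex_Seq[OF rex_mv rex_mv]]]) (auto simp: fun_eq_iff)

text \<open>Register 0 at offset \<open>a\<close> is a frame tape at offset \<open>Suc a\<close>.
  This is how a value is saved while a subroutine runs.\<close>

lemma rex_shift:
  assumes "rex (Suc a) c (Z(0 := y)) (Z(0 := z))"
  shows "rex a c (Z(0 := x, 1 := y)) (Z(0 := x, 1 := z))"
proof -
  have "regs w a (Z(0 := x, 1 := y)) = regs (regs w a (Z(0 := x))) (Suc a) (Z(0 := y))" for w y
    by (auto simp: regs_def fun_eq_iff less_Suc_eq)
  then show ?thesis using assms unfolding rex_def by metis
qed

text \<open>The program may be placed at any offset \<open>a\<close>, and it must return its scratch
  registers to zero. Both are needed for composing programs.\<close>

definition computable :: "(nat \<Rightarrow> nat) \<Rightarrow> bool" where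
  "computable f \<longleftrightarrow> (\<forall>a. \<exists>c. \<forall>x. rex a c (Z(0 := x)) (Z(0 := f x)))"

definition computable2 :: "(nat \<Rightarrow> nat \<Rightarrow> nat) \<Rightarrow> bool" where
  "computable2 F \<longleftrightarrow> (\<forall>a. \<exists>c. \<forall>x y. rex a c (Z(0 := x, 1 := y)) (Z(0 := F x y)))"

lemma computable_comp: "computable g \<Longrightarrow> computable f \<Longrightarrow> computable (\<lambda>x. g (f x))"
  unfolding computable_def by (meson rex_Seq)

lemma computable_bin:
  assumes "computable2 F" "computable f" "computable g"
  shows "computable (\<lambda>x. F (f x) (g x))"
  unfolding computable_def
proof
  fix a
  obtain cf where f: "rex (Suc a) cf (Z(0 := x)) (Z(0 := f x))" for x
    using assms(2) unfolding computable_def by blast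
  obtain cg where g: "rex (Suc a) cg (Z(0 := x)) (Z(0 := g x))" for x
    using assms(3) unfolding computable_def by blast
  obtain cF where F: "rex a cF (Z(0 := x, 1 := y)) (Z(0 := F x y))" for x y
    using assms(1) unfolding computable2_def by blast
  \<comment> \<open>Registers 0 and 1 pass through the contents \<open>x, x\<close>, then
    \<open>x, f x\<close>, then \<open>f x, x\<close>, then \<open>f x, g x\<close>.\<close>
  have "rex a (Seq (dup a) (Seq cf (Seq (swap a) (Seq cg cF)))) (Z(0 := x)) (Z(0 := F (f x) (g x)))"
    for x
    by (rule rex_Seq[OF rex_dup rex_Seq[OF rex_shift[OF f] rex_Seq[OF rex_swap
          rex_Seq[OF rex_shift[OF g] F]]]])
  then show "\<exists>c. \<forall>x. rex a c (Z(0 := x)) (Z(0 := F (f x) (g x)))" by blast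
qed

text \<open>There is no empty command; raising and lowering the scratch register 1 takes its
  place.\<close>

lemma computable_id: "computable (\<lambda>x. x)"
  unfolding computable_def
  by (intro allI exI) (rule rex_eq[OF rex_Seq[OF rex_inc[of _ 1] rex_dec[of _ 1]]], auto simp: fun_eq_iff)

lemma computable_Suc: "computable f \<Longrightarrow> computable (\<lambda>x. Suc (f x))"
proof (rule computable_comp[of Suc f])
  show "computable Suc" unfolding computable_def
    by (intro allI exI) (rule rex_eq[OF rex_inc[of _ 0]], auto simp: fun_eq_iff)
qed

lemma computable_const: "computable (\<lambda>x. k)"
proof (induction k)
  case 0
  show ?case unfolding computable_def
    by (intro allI exI) (rule rex_eq[OF rex_clr[of _ 0]], auto simp: fun_eq_iff)
next
  case (Suc k)
  then show ?case by (rule computable_Suc)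
qed

lemma computable2_add: "computable2 (+)"
  unfolding computable2_def
  by (intro allI exI) (rule rex_eq[OF rex_mv[of 1 0]], auto simp: fun_eq_iff)

lemma computable2_diff: "computable2 (-)"
  unfolding computable2_def
proof
  fix a
  let ?c = "wh a 1 (Seq (dec a 1) (dec a 0))"
  have "rex a ?c (Z(0 := x, 1 := y)) (Z(0 := x - y))" for x y
  proof (induction y arbitrary: x)
    case 0
    then show ?case by (auto simp: fun_eq_iff intro!: rex_eq[OF rex_wh_0])
  next
    case (Suc y)
    have 1: "rex a (Seq (dec a 1) (dec a 0)) (Z(0 := x, 1 := Suc y)) (Z(0 := x - 1, 1 := y))"
      by (rule rex_eq[OF rex_Seq[OF rex_dec rex_dec]]) (auto simp: fun_eq_iff)
    show ?case by (rule rex_eq[OF rex_wh_Suc[OF _ 1 Suc.IH]]) (auto simp: fun_eq_iff)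
  qed
  then show "\<exists>c. \<forall>x y. rex a c (Z(0 := x, 1 := y)) (Z(0 := x - y))" by blast
qed

section \<open>Cantor pairing and iteration on registers\<close>

abbreviation pr :: "nat \<Rightarrow> nat \<Rightarrow> nat" where
  "pr x y \<equiv> prod_encode (x, y)"

definition fs :: "nat \<Rightarrow> nat" where "fs z = fst (prod_decode z)"
definition sn :: "nat \<Rightarrow> nat" where "sn z = snd (prod_decode z)"

lemma fs_pr [simp]: "fs (pr x y) = x" and sn_pr [simp]: "sn (pr x y) = y"
  by (simp_all add: fs_def sn_def)

lemma pr_fs_sn [simp]: "pr (fs z) (sn z) = z"
  by (simp add: fs_def sn_def)

text \<open>The pairing is \<open>triangle (x + y) + x\<close>. The loop adds s, s - 1, ..., 1 to
  register 0, where s starts as \<open>x + y\<close> in register 1.\<close>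

lemma computable2_pr: "computable2 pr"
  unfolding computable2_def
proof
  fix a
  let ?d = "Seq (mv2 a 1 0 2) (Seq (mv a 2 1) (dec a 1))"
  have loop: "rex a (wh a 1 ?d) (Z(0 := r, 1 := s)) (Z(0 := r + triangle s))" for r s
  proof (induction s arbitrary: r)
    case 0
    then show ?case by (auto simp: fun_eq_iff intro!: rex_eq[OF rex_wh_0])
  next
    case (Suc s)
    have 1: "rex a ?d (Z(0 := r, 1 := Suc s)) (Z(0 := r + Suc s, 1 := s))"
      by (rule rex_eq[OF rex_Seq[OF rex_mv2 rex_Seq[OF rex_mv rex_dec]]]) (auto simp: fun_eq_iff)
    show ?case by (rule rex_eq[OF rex_wh_Suc[OF _ 1 Suc.IH]]) (auto simp: fun_eq_iff algebra_simps)
  qed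
  have "rex a (Seq (mv2 a 0 1 2) (mv a 2 0)) (Z(0 := x, 1 := y)) (Z(0 := x, 1 := x + y))" for x y
    by (rule rex_eq[OF rex_Seq[OF rex_mv2 rex_mv]]) (auto simp: fun_eq_iff)
  from rex_Seq[OF this loop]
  have "rex a (Seq (Seq (mv2 a 0 1 2) (mv a 2 0)) (wh a 1 ?d)) (Z(0 := x, 1 := y)) (Z(0 := pr x y))"
    for x y by (simp add: prod_encode_def add.commute)
  then show "\<exists>c. \<forall>x y. rex a c (Z(0 := x, 1 := y)) (Z(0 := pr x y))" by blast
qed

lemma pr_Suc: "pr (Suc m) n = Suc (pr m (Suc n))" "pr 0 (Suc m) = Suc (pr m 0)"
  by (simp_all add: prod_encode_def)

text \<open>No inverse has to be searched for: the program walks along the diagonals from (0, 0) for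
  z steps, passing from (m, 0) to (0, m + 1) and from (m, n + 1) to (m + 1, n).\<close>

lemma rex_unpair: "\<exists>c. \<forall>z. rex a c (Z(0 := z)) (Z(0 := fs z, 1 := sn z))"
proof -
  let ?d = "Seq (dec a 2) (ifz a 1 (Seq (mv a 0 1) (inc a 1)) (Seq (dec a 1) (inc a 0)))"
  have loop: "rex a (wh a 2 ?d) (Z(0 := m, 1 := n, 2 := k))
      (Z(0 := fs (pr m n + k), 1 := sn (pr m n + k)))" for m n k
  proof (induction k arbitrary: m n)
    case 0
    then show ?case by (auto simp: fun_eq_iff intro!: rex_eq[OF rex_wh_0])
  next
    case (Suc k)
    have d: "rex a (dec a 2) (Z(0 := m, 1 := n, 2 := Suc k)) (Z(0 := m, 1 := n, 2 := k))"
      by (rule rex_eq[OF rex_dec]) (auto simp: fun_eq_iff)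
    show ?case
    proof (cases n)
      case 0
      have "rex a (Seq (mv a 0 1) (inc a 1)) (Z(0 := m, 1 := n, 2 := k)) (Z(0 := 0, 1 := Suc m, 2 := k))"
        by (rule rex_eq[OF rex_Seq[OF rex_mv rex_inc]]) (auto simp: fun_eq_iff 0)
      then have 1: "rex a ?d (Z(0 := m, 1 := n, 2 := Suc k)) (Z(0 := 0, 1 := Suc m, 2 := k))"
        using 0 by (intro rex_Seq[OF d] rex_ifz) simp
      show ?thesis by (rule rex_eq[OF rex_wh_Suc[OF _ 1 Suc.IH]]) (auto simp: fun_eq_iff 0 pr_Suc)
    next
      case (Suc n')
      have "rex a (Seq (dec a 1) (inc a 0)) (Z(0 := m, 1 := n, 2 := k)) (Z(0 := Suc m, 1 := n', 2 := k))"
        by (rule rex_eq[OF rex_Seq[OF rex_dec rex_inc]]) (auto simp: fun_eq_iff Suc)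
      then have 1: "rex a ?d (Z(0 := m, 1 := n, 2 := Suc k)) (Z(0 := Suc m, 1 := n', 2 := k))"
        using Suc by (intro rex_Seq[OF d] rex_ifz) simp
      show ?thesis by (rule rex_eq[OF rex_wh_Suc[OF _ 1 Suc.IH]]) (auto simp: fun_eq_iff Suc pr_Suc)
    qed
  qed
  have "rex a (mv a 0 2) (Z(0 := z)) (Z(0 := 0, 1 := 0, 2 := z))" for z
    by (rule rex_eq[OF rex_mv]) (auto simp: fun_eq_iff)
  from rex_Seq[OF this loop]
  have "rex a (Seq (mv a 0 2) (wh a 2 ?d)) (Z(0 := z)) (Z(0 := fs z, 1 := sn z))" for z
    by (simp add: prod_encode_def)
  then show ?thesis by blast
qed

lemma computable_fs: "computable f \<Longrightarrow> computable (\<lambda>x. fs (f x))"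
proof (rule computable_comp[of fs f])
  show "computable fs" unfolding computable_def
  proof
    fix a
    obtain c where c: "rex a c (Z(0 := z)) (Z(0 := fs z, 1 := sn z))" for z using rex_unpair by blast
    have "rex a (Seq c (clr a 1)) (Z(0 := z)) (Z(0 := fs z))" for z
      by (rule rex_eq[OF rex_Seq[OF c rex_clr]]) (auto simp: fun_eq_iff)
    then show "\<exists>c. \<forall>x. rex a c (Z(0 := x)) (Z(0 := fs x))" by blast
  qed
qed

lemma computable_sn: "computable f \<Longrightarrow> computable (\<lambda>x. sn (f x))"
proof (rule computable_comp[of sn f])
  show "computable sn" unfolding computable_def
  proof
    fix a
    obtain c where c: "rex a c (Z(0 := z)) (Z(0 := fs z, 1 := sn z))" for z using rex_unpair by blast
    have "rex a (Seq c (Seq (clr a 0) (mv a 1 0))) (Z(0 := z)) (Z(0 := sn z))" for z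
      by (rule rex_eq[OF rex_Seq[OF c rex_Seq[OF rex_clr rex_mv]]]) (auto simp: fun_eq_iff)
    then show "\<exists>c. \<forall>x. rex a c (Z(0 := x)) (Z(0 := sn x))" by blast
  qed
qed

lemma computable_iterate: "computable b \<Longrightarrow> computable (\<lambda>z. (b ^^ fs z) (sn z))"
  unfolding computable_def
proof
  fix a
  assume *: "\<forall>a. \<exists>c. \<forall>x. rex a c (Z(0 := x)) (Z(0 := b x))"
  then obtain cb where b: "rex (Suc a) cb (Z(0 := x)) (Z(0 := b x))" for x by blast
  obtain c where c: "rex a c (Z(0 := z)) (Z(0 := fs z, 1 := sn z))" for z using rex_unpair by blast
  let ?d = "Seq (dec a 0) cb"
  have loop: "rex a (wh a 0 ?d) (Z(0 := m, 1 := s)) (Z(0 := 0, 1 := (b ^^ m) s))" for m s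
  proof (induction m arbitrary: s)
    case 0
    then show ?case by (auto intro!: rex_wh_0)
  next
    case (Suc m)
    have "rex a (dec a 0) (Z(0 := Suc m, 1 := s)) (Z(0 := m, 1 := s))"
      by (rule rex_eq[OF rex_dec]) (auto simp: fun_eq_iff)
    from rex_Seq[OF this rex_shift[OF b]]
    have 1: "rex a ?d (Z(0 := Suc m, 1 := s)) (Z(0 := m, 1 := b s))" .
    show ?case by (rule rex_eq[OF rex_wh_Suc[OF _ 1 Suc.IH]]) (auto simp: fun_eq_iff funpow_swap1)
  qed
  have m: "rex a (mv a 1 0) (Z(0 := 0, 1 := s)) (Z(0 := s))" for s
    by (rule rex_eq[OF rex_mv]) (auto simp: fun_eq_iff)
  have "rex a (Seq c (Seq (wh a 0 ?d) (mv a 1 0))) (Z(0 := z)) (Z(0 := (b ^^ fs z) (sn z)))" for z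
    by (rule rex_Seq[OF c rex_Seq[OF loop m]])
  then show "\<exists>c. \<forall>z. rex a c (Z(0 := z)) (Z(0 := (b ^^ fs z) (sn z)))" by blast
qed

section \<open>Closure properties of computable functions\<close>

named_theorems computable_intros

lemmas [computable_intros] = computable_id computable_const computable_Suc computable_fs computable_sn

lemma computable_add [computable_intros]: "computable f \<Longrightarrow> computable g \<Longrightarrow> computable (\<lambda>x. f x + g x)"
  by (rule computable_bin[OF computable2_add])

lemma computable_diff [computable_intros]: "computable f \<Longrightarrow> computable g \<Longrightarrow> computable (\<lambda>x. f x - g x)"
  by (rule computable_bin[OF computable2_diff])

lemma computable_pr [computable_intros]: "computable f \<Longrightarrow> computable g \<Longrightarrow> computable (\<lambda>x. pr (f x) (g x))"
  by (rule computable_bin[OF computable2_pr])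

text \<open>The iterated function may depend on the argument \<open>x\<close>, so \<open>x\<close>
  is carried along as the first component of the state. Functions of two arguments are always
  presented through \<open>fs\<close> and \<open>sn\<close> of one number, as in the third
  hypothesis.\<close>

lemma computable_funpow:
  assumes "computable n" "computable a" "computable (\<lambda>z. b (fs z) (sn z))"
  shows "computable (\<lambda>x. (b x ^^ n x) (a x))"
proof -
  define B where "B = (\<lambda>z. pr (fs z) (b (fs z) (sn z)))"
  have "computable B" unfolding B_def by (intro computable_intros assms)
  then have *: "computable (\<lambda>x. (B ^^ fs (pr (n x) (pr x (a x)))) (sn (pr (n x) (pr x (a x)))))"
    by (intro computable_comp[OF computable_iterate] computable_intros assms)
  have "(B ^^ k) (pr x s) = pr x ((b x ^^ k) s)" for k x s
    by (induction k) (simp_all add: B_def)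
  with * have "computable (\<lambda>x. pr x ((b x ^^ n x) (a x)))" by simp
  from computable_sn[OF this] show ?thesis by simp
qed

lemma computable_mult [computable_intros]:
  assumes "computable f" "computable g"
  shows "computable (\<lambda>x. f x * g x)"
proof -
  have "((\<lambda>s. s + m) ^^ k) 0 = m * k" for m k :: nat
    by (induction k) simp_all
  moreover have "computable (\<lambda>x. ((\<lambda>s. s + f x) ^^ g x) 0)"
    by (intro computable_funpow computable_intros assms computable_comp[OF assms(1)])
  ultimately show ?thesis by simp
qed

lemma computable_pow2 [computable_intros]:
  assumes "computable f"
  shows "computable (\<lambda>x. 2 ^ f x)"
proof -
  have "((\<lambda>s. s + s) ^^ k) 1 = (2::nat) ^ k" for k
    by (induction k) simp_all
  moreover have "computable (\<lambda>x. ((\<lambda>s. s + s) ^^ f x) 1)"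
    by (intro computable_funpow computable_intros assms)
  ultimately show ?thesis by simp
qed

text \<open>The iteration keeps the next index and the partial sum. Bounded quantifiers, division,
  lengths and ranks in enumerations are all reduced to such sums.\<close>

lemma computable_sum [computable_intros]:
  assumes n: "computable n" and f: "computable (\<lambda>z. f (fs z) (sn z))"
  shows "computable (\<lambda>x. \<Sum>i<n x. f x i)"
proof -
  have "((\<lambda>s. pr (Suc (fs s)) (sn s + f x (fs s))) ^^ k) (pr 0 0) = pr k (\<Sum>i<k. f x i)" for x k
    by (induction k) simp_all
  moreover have "computable (\<lambda>z. f (fs z) (fs (sn z)))"
    using computable_comp[OF f, of "\<lambda>z. pr (fs z) (fs (sn z))"] by (simp add: computable_intros)
  then have "computable (\<lambda>x. sn (((\<lambda>s. pr (Suc (fs s)) (sn s + f x (fs s))) ^^ n x) (pr 0 0)))"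
    by (intro computable_funpow computable_intros n)
  ultimately show ?thesis by simp
qed

abbreviation decidable :: "(nat \<Rightarrow> bool) \<Rightarrow> bool" where
  "decidable P \<equiv> computable (\<lambda>x. of_bool (P x))"

lemma decidable_le [computable_intros]: "computable f \<Longrightarrow> computable g \<Longrightarrow> decidable (\<lambda>x. f x \<le> g x)"
proof -
  assume *: "computable f" "computable g"
  have "of_bool (a \<le> b) = 1 - (a - b)" for a b :: nat by auto
  then show ?thesis by (simp only:) (intro computable_intros *)
qed

lemma decidable_not [computable_intros]: "decidable P \<Longrightarrow> decidable (\<lambda>x. \<not> P x)"
proof -
  assume *: "decidable P"
  have "of_bool (\<not> a) = 1 - (of_bool a :: nat)" for a by auto
  then show ?thesis by (simp only:) (intro computable_intros *)
qed

lemma decidable_conj [computable_intros]: "decidable P \<Longrightarrow> decidable Q \<Longrightarrow> decidable (\<lambda>x. P x \<and> Q x)"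
  by (simp only: of_bool_conj) (rule computable_mult)

lemma decidable_less [computable_intros]: "computable f \<Longrightarrow> computable g \<Longrightarrow> decidable (\<lambda>x. f x < g x)"
  using decidable_le[of "\<lambda>x. Suc (f x)" g] by (simp add: Suc_le_eq computable_Suc)

lemma decidable_eq [computable_intros]: "computable f \<Longrightarrow> computable g \<Longrightarrow> decidable (\<lambda>x. f x = g x)"
  by (simp only: order_eq_iff) (intro computable_intros)

lemma computable_if [computable_intros]:
  assumes "decidable P" "computable f" "computable g"
  shows "computable (\<lambda>x. if P x then f x else g x)"
proof -
  have "(if a then b else c) = of_bool a * b + of_bool (\<not> a) * c" for a and b c :: nat by auto
  then show ?thesis by (simp only:) (intro computable_intros assms)
qed

lemma decidable_ex [computable_intros]:
  assumes n: "computable n" and P: "decidable (\<lambda>z. P (fs z) (sn z))"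
  shows "decidable (\<lambda>x. \<exists>i<n x. P x i)"
proof -
  have "(\<exists>i<n x. P x i) \<longleftrightarrow> 0 < (\<Sum>i<n x. of_bool (P x i) :: nat)" for x
    by (auto simp: sum_pos2 zero_less_iff_neq_zero)
  then show ?thesis by (simp only:) (intro computable_intros assms)
qed

lemma decidable_all [computable_intros]:
  assumes n: "computable n" and P: "decidable (\<lambda>z. P (fs z) (sn z))"
  shows "decidable (\<lambda>x. \<forall>i<n x. P x i)"
proof -
  have "(\<forall>i<n x. P x i) \<longleftrightarrow> \<not> (\<exists>i<n x. \<not> P x i)" for x by auto
  then show ?thesis by (simp only:) (intro computable_intros assms)
qed

text \<open>The quotient by a constant is the number of positive multiples of \<open>k\<close> up to
  the dividend.\<close>

lemma computable_div [computable_intros]: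
  assumes f: "computable f" and "0 < k"
  shows "computable (\<lambda>x. f x div k)"
proof -
  have "n div k = (\<Sum>i<n. of_bool (Suc i * k \<le> n))" for n
  proof -
    have "Suc i * k \<le> n \<longleftrightarrow> i < n div k" for i
      using less_eq_div_iff_mult_less_eq[OF \<open>0 < k\<close>, of "Suc i" n] by (simp add: Suc_le_eq)
    then have "(\<Sum>i<n. of_bool (Suc i * k \<le> n)) = card ({..<n} \<inter> {i. i < n div k})"
      by simp
    also have "{..<n} \<inter> {i. i < n div k} = {..<n div k}"
      using div_le_dividend[of n k] by (auto intro: less_le_trans)
    finally show ?thesis by simp
  qed
  then show ?thesis
    by (simp only:) (intro computable_intros f computable_comp[OF f])
qed

lemma computable_mod [computable_intros]:
  assumes f: "computable f" and "0 < k"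
  shows "computable (\<lambda>x. f x mod k)"
proof -
  have "computable (\<lambda>x. f x - k * (f x div k))" by (intro computable_intros assms)
  then show ?thesis by (simp only: minus_mult_div_eq_mod)
qed

text \<open>A finite case distinction; it is what makes transition tables computable.\<close>

lemma computable_finite_support:
  assumes "finite {x. f x \<noteq> 0}"
  shows "computable f"
proof -
  have "computable (\<lambda>x. if x \<in> A then f x else 0)" if "finite A" for A
    using that
  proof induction
    case empty
    show ?case by (simp add: computable_const)
  next
    case (insert a A)
    have "(if x \<in> insert a A then f x else 0) = (if x = a then f a else if x \<in> A then f x else 0)" for x
      by auto
    then show ?case by (simp only:) (intro computable_intros insert.IH)
  qed
  moreover have "(\<lambda>x. if x \<in> {x. f x \<noteq> 0} then f x else 0) = f" by auto
  ultimately show ?thesis using assms by metis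
qed

section \<open>Strings as numbers\<close>

text \<open>Bijective base 2 with digits 1 and 2, most significant digit first.\<close>

definition digit :: "bool \<Rightarrow> nat" where "digit b = (if b then 2 else 1)"

definition num :: "bool list \<Rightarrow> nat" where
  "num w = foldl (\<lambda>c b. 2 * c + digit b) 0 w"

lemma num_Nil [simp]: "num [] = 0"
  by (simp add: num_def)

lemma num_snoc: "num (w @ [b]) = 2 * num w + digit b"
  by (simp add: num_def)

lemma num_append: "num (u @ v) = num u * 2 ^ length v + num v"
  by (induction v rule: rev_induct)
    (simp_all add: num_snoc algebra_simps append_assoc[symmetric] del: append_assoc)

text \<open>The words of length r occupy the codes c with 2^r \<le> c + 1 < 2^(r + 1), so lengths
  and bounds on lengths become arithmetic conditions on codes.\<close>

lemma num_bounds: "2 ^ length w \<le> Suc (num w)" "Suc (num w) < 2 ^ Suc (length w)"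
  by (induction w rule: rev_induct) (auto simp: num_snoc digit_def)

lemma num_surj: "\<exists>w. num w = c"
proof (induction c rule: less_induct)
  case (less c)
  show ?case
  proof (cases c)
    case 0
    then show ?thesis using num_Nil by blast
  next
    case (Suc d)
    have "d div 2 < c" using Suc by simp
    then obtain w where w: "num w = d div 2" using less by blast
    have "num (w @ [odd d]) = c"
      using Suc by (simp add: num_snoc digit_def w)
    then show ?thesis by blast
  qed
qed

lemma num_inj: "num u = num v \<longleftrightarrow> u = v"
proof
  show "num u = num v \<Longrightarrow> u = v"
  proof (induction u arbitrary: v rule: rev_induct)
    case Nil
    then show ?case by (cases v rule: rev_cases) (auto simp: num_snoc digit_def split: if_splits)
  next
    case (snoc b u)
    then obtain v' b' where v: "v = v' @ [b']"
      by (cases v rule: rev_cases) (auto simp: num_snoc digit_def split: if_splits)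
    have "2 * num u + digit b = 2 * num v' + digit b'" using snoc.prems by (simp add: v num_snoc)
    then have "b = b' \<and> num u = num v'"
      by (auto simp: digit_def split: if_splits; presburger)
    then show ?case using snoc.IH v by blast
  qed
qed simp

lemma length_le_num: "length w \<le> num w"
  by (induction w rule: rev_induct) (auto simp: num_snoc digit_def)

text \<open>The length is written as a bounded count of powers of 2 so that the closure properties
  apply to it.\<close>

definition len :: "nat \<Rightarrow> nat" where
  "len c = (\<Sum>i<c. of_bool (2 ^ Suc i \<le> Suc c))"

lemma len_num [simp]: "len (num w) = length w"
proof -
  have "2 ^ Suc i \<le> Suc (num w) \<longleftrightarrow> i < length w" for i
  proof
    assume "2 ^ Suc i \<le> Suc (num w)"
    then have "2 ^ Suc i < (2::nat) ^ Suc (length w)" using num_bounds(2)[of w] by linarith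
    then show "i < length w" by (simp add: power_strict_increasing_iff del: power_Suc)
  next
    assume "i < length w"
    then have "2 ^ Suc i \<le> (2::nat) ^ length w" by (intro power_increasing) auto
    then show "2 ^ Suc i \<le> Suc (num w)" using num_bounds(1)[of w] by linarith
  qed
  moreover have "{..<num w} \<inter> {i. i < length w} = {..<length w}" using length_le_num[of w] by auto
  ultimately show ?thesis by (simp add: len_def)
qed

lemma computable_len [computable_intros]:
  assumes "computable f" shows "computable (\<lambda>x. len (f x))"
proof -
  have "computable len" unfolding len_def by (intro computable_intros)
  from computable_comp[OF this assms] show ?thesis .
qed

lemma bin_rep_nonempty: "bin_rep n \<noteq> []"
  by (subst bin_rep.simps) simp

text \<open>The code of a binary representation \<open>w\<close> exceeds its value by \<open>2 ^ length w - 1\<close>.\<close>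

definition bval :: "nat \<Rightarrow> nat" where
  "bval c = Suc c - 2 ^ len c"

lemma num_bin_rep: "Suc (num (bin_rep n)) = n + 2 ^ length (bin_rep n)"
proof (induction n rule: bin_rep.induct)
  case (1 n)
  show ?case
  proof (cases "n < 2")
    case True
    then show ?thesis
      by (subst (1 2) bin_rep.simps) (auto simp: num_def digit_def)
  next
    case False
    then show ?thesis using 1 num_snoc
      by (subst (1 2) bin_rep.simps) (auto simp: num_snoc digit_def elim!: evenE oddE)
  qed
qed

lemma bval_bin_rep [simp]: "bval (num (bin_rep n)) = n"
  using num_bin_rep[of n] by (simp add: bval_def)

lemma computable_bval [computable_intros]: "computable f \<Longrightarrow> computable (\<lambda>x. bval (f x))"
  unfolding bval_def by (intro computable_intros)

text \<open>By \<open>num_bin_rep\<close> the code of a binary representation is known once its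
  length is. The sum is the integer part of the binary logarithm, and 0 for
  \<open>n = 0\<close>.\<close>

definition brep :: "nat \<Rightarrow> nat" where
  "brep n = n + 2 ^ Suc (\<Sum>i<n. of_bool (2 ^ Suc i \<le> n)) - 1"

lemma length_bin_rep: "length (bin_rep n) = Suc (\<Sum>i<n. of_bool (2 ^ Suc i \<le> n))"
proof -
  \<comment> \<open>The guard on the lower bound is for \<open>n = 0\<close>, whose representation
    has length 1 all the same.\<close>
  have *: "n < 2 ^ length (bin_rep n) \<and> (1 < length (bin_rep n) \<longrightarrow> 2 ^ (length (bin_rep n) - 1) \<le> n)"
  proof (induction n rule: bin_rep.induct)
    case (1 n)
    show ?case
    proof (cases "n < 2")
      case True
      then show ?thesis by (subst (1 2 3) bin_rep.simps) auto
    next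
      case False
      then have IH: "n div 2 < 2 ^ length (bin_rep (n div 2))"
        "1 < length (bin_rep (n div 2)) \<longrightarrow> 2 ^ (length (bin_rep (n div 2)) - 1) \<le> n div 2"
        using 1 by auto
      have l: "length (bin_rep n) = Suc (length (bin_rep (n div 2)))"
        using False by (subst bin_rep.simps) simp
      obtain m where m: "length (bin_rep (n div 2)) = Suc m"
        using bin_rep_nonempty[of "n div 2"] by (cases "bin_rep (n div 2)") auto
      show ?thesis using IH False unfolding l m by (cases m) auto
    qed
  qed
  obtain m where m: "length (bin_rep n) = Suc m"
    using bin_rep_nonempty[of n] by (cases "bin_rep n") auto
  have "2 ^ Suc i \<le> n \<longleftrightarrow> i < m" for i
  proof
    assume "2 ^ Suc i \<le> n"
    then have "2 ^ Suc i < (2::nat) ^ Suc m" using * unfolding m by linarith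
    then show "i < m" by (simp add: power_strict_increasing_iff del: power_Suc)
  next
    assume "i < m"
    then have "2 ^ Suc i \<le> (2::nat) ^ m" by (intro power_increasing) auto
    then show "2 ^ Suc i \<le> n" using * \<open>i < m\<close> unfolding m by simp
  qed
  moreover have "m \<le> n"
  proof (cases "m = 0")
    case False
    then have "2 ^ m \<le> n" using * m by simp
    then show ?thesis using less_exp[of m] by linarith
  qed simp
  then have "{..<n} \<inter> {i. i < m} = {..<m}" by auto
  ultimately show ?thesis by (simp add: m)
qed

lemma brep [simp]: "brep n = num (bin_rep n)"
  using num_bin_rep[of n] by (simp add: brep_def length_bin_rep)

lemma computable_num_bin_rep [computable_intros]:
  assumes "computable f" shows "computable (\<lambda>x. num (bin_rep (f x)))"
proof -
  have "computable brep" unfolding brep_def by (intro computable_intros)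
  from computable_comp[OF this assms] show ?thesis by simp
qed

section \<open>Turing machine steps on codes\<close>

definition dsym :: "symbol \<Rightarrow> nat" where
  "dsym s = (case s of None \<Rightarrow> 0 | Some b \<Rightarrow> digit b)"

lemma dsym_lt: "dsym s < 3" and dsym_eq [simp]: "dsym s = dsym s' \<longleftrightarrow> s = s'"
  and dsym_0 [simp]: "dsym s = 0 \<longleftrightarrow> s = None" and dsym_Some [simp]: "dsym (Some b) = digit b"
  by (auto simp: dsym_def digit_def split: option.splits)

lemma dsym_None [simp]: "dsym None = 0"
  by (simp add: dsym_def)

text \<open>Base 3 with the head cell in the lowest place turns reading and moving into arithmetic
  modulo 3. The blank is the digit 0, so trailing blanks do not affect the code.\<close>

fun dig :: "symbol list \<Rightarrow> nat" where
  "dig [] = 0"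
| "dig (s # xs) = dsym s + 3 * dig xs"

lemma dig_mod [simp]: "dig xs mod 3 = dsym (head_cell xs)"
  using dsym_lt by (cases xs) (simp_all add: head_cell_def)

lemma dig_div [simp]: "dig xs div 3 = dig (tl xs)"
  using dsym_lt by (cases xs) (simp_all add: head_cell_def)

fun tcode :: "tape \<Rightarrow> nat" where
  "tcode (l, r) = pr (dig l) (dig r)"

fun tscode :: "tape list \<Rightarrow> nat" where
  "tscode [] = 0"
| "tscode (t # ts) = pr (tcode t) (tscode ts)"

fun ccode :: "config \<Rightarrow> nat" where
  "ccode (q, ts) = pr q (tscode ts)"

fun dmove :: "move \<Rightarrow> nat" where
  "dmove MoveL = 0" | "dmove Stay = 1" | "dmove MoveR = 2"

fun acode :: "symbol \<times> move \<Rightarrow> nat" where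
  "acode (s, m) = pr (dsym s) (dmove m)"

fun ascode :: "(symbol \<times> move) list \<Rightarrow> nat" where
  "ascode [] = 0"
| "ascode (a # as) = pr (acode a) (ascode as)"

definition actn :: "nat \<Rightarrow> nat \<Rightarrow> nat" where
  "actn a t = (if sn a = 0 then pr (fs t div 3) (fs t mod 3 + 3 * (fs a + 3 * (sn t div 3)))
     else if sn a = 1 then pr (fs t) (fs a + 3 * (sn t div 3))
     else pr (fs a + 3 * fs t) (sn t div 3))"

lemma actn: "actn (acode a) (tcode t) = tcode (act_tape a t)"
proof -
  obtain s m l r where "a = (s, m)" "t = (l, r)" by (metis surj_pair)
  then show ?thesis by (cases m) (simp_all add: actn_def head_cell_def)
qed

text \<open>For a fixed machine the number of tapes is a constant, so this recursion is unfolded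
  from outside and each \<open>k\<close> gives one computable function.\<close>

fun actsn :: "nat \<Rightarrow> nat \<Rightarrow> nat \<Rightarrow> nat" where
  "actsn 0 as ts = 0"
| "actsn (Suc k) as ts = pr (actn (fs as) (fs ts)) (actsn k (sn as) (sn ts))"

lemma actsn:
  "length as = length ts \<Longrightarrow> actsn (length ts) (ascode as) (tscode ts) = tscode (map2 act_tape as ts)"
  by (induction as ts rule: list_induct2) (simp_all add: actn)

lemma computable_actn [computable_intros]: "computable f \<Longrightarrow> computable g \<Longrightarrow> computable (\<lambda>x. actn (f x) (g x))"
  unfolding actn_def by (intro computable_intros) simp_all

lemma computable_actsn [computable_intros]: "computable f \<Longrightarrow> computable g \<Longrightarrow> computable (\<lambda>x. actsn k (f x) (g x))"
  by (induction k arbitrary: f g) (simp_all add: computable_intros)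

fun scode :: "symbol list \<Rightarrow> nat" where
  "scode [] = 0"
| "scode (s # ss) = pr (dsym s) (scode ss)"

lemma scode_inj: "length s = length s' \<Longrightarrow> scode s = scode s' \<longleftrightarrow> s = s'"
  by (induction s s' rule: list_induct2) simp_all

fun symsn :: "nat \<Rightarrow> nat \<Rightarrow> nat" where
  "symsn 0 ts = 0"
| "symsn (Suc k) ts = pr (sn (fs ts) mod 3) (symsn k (sn ts))"

lemma symsn: "symsn (length ts) (tscode ts) = scode (map read_tape ts)"
proof (induction ts)
  case (Cons t ts)
  then show ?case by (cases t) (simp add: read_tape_def)
qed simp

lemma computable_symsn [computable_intros]: "computable f \<Longrightarrow> computable (\<lambda>x. symsn k (f x))"
proof (induction k arbitrary: f)
  case (Suc k)
  show ?case unfolding symsn.simps by (intro computable_intros Suc) simp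
qed (simp add: computable_const)

text \<open>\<open>delta\<close> is an arbitrary function on an infinite domain. Keeping only the
  arguments that a valid configuration can supply leaves a finite table.\<close>

definition key :: "tm \<Rightarrow> nat \<Rightarrow> symbol list \<Rightarrow> nat \<Rightarrow> bool" where
  "key M q s k \<longleftrightarrow> q < num_states M \<and> length s = num_tapes M \<and> k = pr q (scode s)"

text \<open>The entry \<open>0\<close> stands for halting.\<close>

definition table :: "tm \<Rightarrow> nat \<Rightarrow> nat" where
  "table M k = (if \<exists>q s. key M q s k then
     (case (SOME (q, s). key M q s k) of (q, s) \<Rightarrow>
        (case delta M q s of None \<Rightarrow> 0 | Some (q', as) \<Rightarrow> Suc (pr q' (ascode as)))) else 0)"

lemma table:
  assumes "q < num_states M" "length s = num_tapes M"
  shows "table M (pr q (scode s)) =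
    (case delta M q s of None \<Rightarrow> 0 | Some (q', as) \<Rightarrow> Suc (pr q' (ascode as)))"
proof -
  have k: "key M q s (pr q (scode s))" using assms by (simp add: key_def)
  have "(SOME (q', s'). key M q' s' (pr q (scode s))) = (q, s)"
    by (rule some_equality) (use k in \<open>auto simp: key_def scode_inj\<close>)
  then show ?thesis using k by (auto simp: table_def)
qed

lemma computable_table: "computable (table M)"
proof (rule computable_finite_support)
  have "{x. table M x \<noteq> 0} \<subseteq> (\<lambda>(q, s). pr q (scode s)) `
      ({..<num_states M} \<times> {s. set s \<subseteq> UNIV \<and> length s = num_tapes M})"
    by (force simp: table_def key_def split: if_splits)
  moreover have "finite {s :: symbol list. set s \<subseteq> UNIV \<and> length s = num_tapes M}"
    by (rule finite_lists_length_eq) simp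
  ultimately show "finite {x. table M x \<noteq> 0}" by (auto intro: finite_subset)
qed

lemmas computable_table' [computable_intros] = computable_comp[OF computable_table]

definition entry :: "tm \<Rightarrow> nat \<Rightarrow> nat" where
  "entry M z = table M (pr (fs z) (symsn (num_tapes M) (sn z)))"

definition stepn :: "tm \<Rightarrow> nat \<Rightarrow> nat" where
  "stepn M z = (if entry M z = 0 then z
     else pr (fs (entry M z - 1)) (actsn (num_tapes M) (sn (entry M z - 1)) (sn z)))"

lemma computable_entry [computable_intros]: "computable f \<Longrightarrow> computable (\<lambda>x. entry M (f x))"
  unfolding entry_def by (intro computable_intros)

lemma computable_stepn [computable_intros]: "computable f \<Longrightarrow> computable (\<lambda>x. stepn M (f x))"
  unfolding stepn_def by (intro computable_intros)

definition valid :: "tm \<Rightarrow> config \<Rightarrow> bool" where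
  "valid M c \<longleftrightarrow> fst c < num_states M \<and> length (snd c) = num_tapes M"

lemma entry:
  assumes "valid M c"
  shows "entry M (ccode c) = (case delta M (fst c) (map read_tape (snd c)) of
    None \<Rightarrow> 0 | Some (q', as) \<Rightarrow> Suc (pr q' (ascode as)))"
proof -
  obtain q ts where c: "c = (q, ts)" by (cases c)
  then show ?thesis using assms symsn[of ts] table[of q M "map read_tape ts"]
    by (simp add: valid_def entry_def)
qed

lemma entry_halted: "valid M c \<Longrightarrow> entry M (ccode c) = 0 \<longleftrightarrow> tm_halted M c"
  by (auto simp: entry tm_halted_def split: option.splits)

lemma stepn:
  assumes M: "turing_machine M" and v: "valid M c"
  shows "stepn M (ccode c) = ccode (tm_step M c) \<and> valid M (tm_step M c)"
proof (cases "delta M (fst c) (map read_tape (snd c))")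
  case None
  then show ?thesis using v by (simp add: stepn_def entry tm_step_def)
next
  case (Some qa)
  obtain q' as where qa: "qa = (q', as)" by (cases qa)
  obtain q ts where c: "c = (q, ts)" by (cases c)
  have "length (map read_tape (snd c)) = num_tapes M" using v by (simp add: valid_def)
  then have "q' < num_states M" "length as = num_tapes M"
    using M v Some unfolding turing_machine_def valid_def qa by blast+
  moreover have "entry M (ccode c) = Suc (pr q' (ascode as))"
    using Some by (simp add: entry[OF v] qa)
  ultimately show ?thesis using v Some actsn[of as ts]
    by (simp add: stepn_def tm_step_def qa c valid_def)
qed

lemma stepn_funpow:
  assumes M: "turing_machine M" and v: "valid M c"
  shows "(stepn M ^^ N) (ccode c) = ccode ((tm_step M ^^ N) c) \<and> valid M ((tm_step M ^^ N) c)"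
  using v by (induction N) (simp_all add: stepn[OF M])

section \<open>Conversion between word codes and tape codes\<close>

definition inp_step :: "nat \<Rightarrow> nat" where
  "inp_step s = (if fs s = 0 then s
     else pr ((fs s - 1) div 2) ((if fs s mod 2 = 0 then 2 else 1) + 3 * sn s))"

definition inp :: "nat \<Rightarrow> nat" where
  "inp c = sn ((inp_step ^^ c) (pr c 0))"

lemma funpow_fixed: "f x = x \<Longrightarrow> (f ^^ n) x = x"
  by (induction n) simp_all

text \<open>Each round strips off the last letter, which is the lowest digit, and pushes it on the
  tape, so the first letter ends up at the head. Code 0 is a fixed point; hence \<open>num w\<close>
  rounds are as good as \<open>length w\<close>.\<close>

lemma inp: "inp (num w) = dig (map Some w)"
proof -
  have step: "inp_step (pr (num (w @ [b])) (dig r)) = pr (num w) (dig (Some b # r))" for w b r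
    by (auto simp: inp_step_def num_snoc digit_def)
  have "(inp_step ^^ length w) (pr (num w) (dig r)) = pr 0 (dig (map Some w @ r))" for r
  proof (induction w arbitrary: r rule: rev_induct)
    case (snoc b w)
    have "(inp_step ^^ length (w @ [b])) (pr (num (w @ [b])) (dig r)) =
        (inp_step ^^ length w) (pr (num w) (dig (Some b # r)))"
      using step by (simp add: funpow_swap1)
    then show ?case using snoc.IH[of "Some b # r"] by simp
  qed simp
  from this[of "[]"] have *: "(inp_step ^^ length w) (pr (num w) 0) = pr 0 (dig (map Some w))" by simp
  have "(inp_step ^^ num w) (pr (num w) 0) =
      (inp_step ^^ (num w - length w)) ((inp_step ^^ length w) (pr (num w) 0))"
    using length_le_num[of w] by (metis comp_apply funpow_add le_add_diff_inverse2)
  also have "\<dots> = pr 0 (dig (map Some w))"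
    unfolding * by (rule funpow_fixed) (simp add: inp_step_def)
  finally show ?thesis by (simp add: inp_def)
qed

definition outp_step :: "nat \<Rightarrow> nat" where
  "outp_step s = (if fs s mod 3 = 0 then s else pr (fs s div 3) (2 * sn s + fs s mod 3))"

definition outp :: "nat \<Rightarrow> nat" where
  "outp r = sn ((outp_step ^^ r) (pr r 0))"

text \<open>Letters leave the tape at the head and are appended to the word. A blank is a fixed
  point and every other round lowers the tape code, so that code bounds the number of
  rounds.\<close>

lemma outp: "outp (dig r) = num (map the (takeWhile (\<lambda>s. s \<noteq> None) r))"
proof -
  have "sn ((outp_step ^^ N) (pr (dig r) (num w))) = num (w @ map the (takeWhile (\<lambda>s. s \<noteq> None) r))"
    if "dig r \<le> N" for N w
    using that
  proof (induction r arbitrary: N w)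
    case Nil
    then show ?case by (subst funpow_fixed) (simp_all add: outp_step_def)
  next
    case (Cons s r)
    show ?case
    proof (cases s)
      case None
      then show ?thesis by (subst funpow_fixed) (simp_all add: outp_step_def)
    next
      case (Some b)
      then obtain N' where N: "N = Suc N'" using Cons.prems by (cases N) (auto simp: digit_def split: if_splits)
      have d: "digit b + 3 * dig r = dig (Some b # r)" by simp
      have "outp_step (pr (dig (s # r)) (num w)) = pr (dig r) (num (w @ [b]))"
        unfolding outp_step_def fs_pr sn_pr dig_mod dig_div
        by (simp add: Some num_snoc head_cell_def digit_def)
      then have "(outp_step ^^ N) (pr (dig (s # r)) (num w)) =
          (outp_step ^^ N') (pr (dig r) (num (w @ [b])))" by (simp add: N funpow_swap1 del: dig.simps)
      moreover have "dig r \<le> N'" using Cons.prems by (simp add: N Some digit_def split: if_splits)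
      ultimately show ?thesis using Cons.IH[of N' "w @ [b]"] by (simp add: Some del: dig.simps)
    qed
  qed
  from this[of "dig r" "[]"] show ?thesis by (simp add: outp_def)
qed

lemma computable_inp [computable_intros]: assumes "computable f" shows "computable (\<lambda>x. inp (f x))"
proof -
  have "computable inp" unfolding inp_def inp_step_def by (intro computable_funpow computable_intros) simp_all
  from computable_comp[OF this assms] show ?thesis .
qed

lemma computable_outp [computable_intros]: assumes "computable f" shows "computable (\<lambda>x. outp (f x))"
proof -
  have "computable outp" unfolding outp_def outp_step_def by (intro computable_funpow computable_intros) simp_all
  from computable_comp[OF this assms] show ?thesis .
qed

definition cfg :: "tm \<Rightarrow> nat \<Rightarrow> nat \<Rightarrow> nat \<Rightarrow> nat" where
  "cfg M p v N = (stepn M ^^ N) (pr 0 (pr (pr 0 (inp p)) (pr (pr 0 (inp v))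
     (tscode (replicate (num_tapes M - 2) ([], []))))))"

definition haltn :: "tm \<Rightarrow> nat \<Rightarrow> nat \<Rightarrow> nat \<Rightarrow> bool" where
  "haltn M p v N \<longleftrightarrow> entry M (cfg M p v N) = 0"

text \<open>The projections discard the state and tapes 0 and 1 and select the right half of tape
  2.\<close>

definition outn :: "tm \<Rightarrow> nat \<Rightarrow> nat \<Rightarrow> nat \<Rightarrow> nat" where
  "outn M p v N = outp (sn (fs (sn (sn (sn (cfg M p v N))))))"

lemma computable_cfg [computable_intros]:
  assumes "computable p" "computable v" "computable N"
  shows "computable (\<lambda>x. cfg M (p x) (v x) (N x))"
proof -
  have "computable (\<lambda>z. (stepn M ^^ fs z) (sn z))"
    by (intro computable_iterate computable_stepn computable_id)
  from computable_comp[OF this, of "\<lambda>x. pr (N x) (pr 0 (pr (pr 0 (inp (p x))) (pr (pr 0 (inp (v x)))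
     (tscode (replicate (num_tapes M - 2) ([], []))))))"]
  show ?thesis unfolding cfg_def by (simp add: computable_intros assms)
qed

lemma computable_haltn [computable_intros]:
  "computable p \<Longrightarrow> computable v \<Longrightarrow> computable N \<Longrightarrow> decidable (\<lambda>x. haltn M (p x) (v x) (N x))"
  unfolding haltn_def by (intro computable_intros)

lemma computable_outn [computable_intros]:
  "computable p \<Longrightarrow> computable v \<Longrightarrow> computable N \<Longrightarrow> computable (\<lambda>x. outn M (p x) (v x) (N x))"
  unfolding outn_def by (intro computable_intros)

lemma simulation:
  assumes M: "turing_machine M"
  defines "c \<equiv> \<lambda>p v N. (tm_step M ^^ N) (tm_init M p v)"
  shows "haltn M (num p) (num v) N \<longleftrightarrow> tm_halted M (c p v N)"
    and "outn M (num p) (num v) N = num (tm_output (c p v N))"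
proof -
  have "valid M (tm_init M p v)"
    using M by (auto simp: turing_machine_def valid_def tm_init_def)
  moreover have "cfg M (num p) (num v) N = (stepn M ^^ N) (ccode (tm_init M p v))"
    by (simp add: cfg_def tm_init_def inp)
  ultimately have e: "cfg M (num p) (num v) N = ccode (c p v N)" and v: "valid M (c p v N)"
    using stepn_funpow[OF M, of "tm_init M p v" N] by (simp_all add: c_def)
  show "haltn M (num p) (num v) N \<longleftrightarrow> tm_halted M (c p v N)"
    using entry_halted[OF v] by (simp add: haltn_def e)
  obtain q ts where qts: "c p v N = (q, ts)" by (cases "c p v N")
  have "3 \<le> length ts" using v M by (simp add: qts valid_def turing_machine_def)
  then obtain t0 t1 l r ts' where ts: "ts = t0 # t1 # (l, r) # ts'"
    by (metis Suc_le_length_iff numeral_3_eq_3 surj_pair)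
  show "outn M (num p) (num v) N = num (tm_output (c p v N))"
    by (simp add: outn_def e qts ts tm_output_def outp)
qed

section \<open>Machines for unbounded search\<close>

lemma rexD: "rex a c e e' \<Longrightarrow> run c (regs w a e) (regs w a e')"
  by (simp add: rex_def)

text \<open>Horner's rule for \<open>num\<close>. The tape being read belongs to the frame and is
  emptied, while register 0 accumulates the code.\<close>

lemma run_read_tape:
  assumes c1: "\<And>x. rex a c1 (Z(0 := x)) (Z(0 := 2 * x + 1))"
    and c2: "\<And>x. rex a c2 (Z(0 := x)) (Z(0 := 2 * x + 2))"
    and i: "i < a"
  shows "run (while_stk i (Seq (Cond i (\<lambda>s. s = Some True) c2 c1) (pop i)))
    (regs w a (Z(0 := num u))) (regs (w(i := [])) a (Z(0 := num (u @ w i))))"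
proof -
  have "w i = v \<Longrightarrow> run (while_stk i (Seq (Cond i (\<lambda>s. s = Some True) c2 c1) (pop i)))
    (regs w a (Z(0 := num u))) (regs (w(i := [])) a (Z(0 := num (u @ v))))" for v
  proof (induction v arbitrary: w u)
    case Nil
    then have "regs w a (Z(0 := num u)) i = []" "w(i := []) = w" using i by (auto simp: regs_def)
    then show ?case using run_while_Nil[of "regs w a (Z(0 := num u))" i] by (simp only: append_Nil2)
  next
    case (Cons b v)
    have hd: "regs w a (Z(0 := num u)) i = b # v" using i Cons.prems by (simp add: regs_def)
    have "rex a (if b then c2 else c1) (Z(0 := num u)) (Z(0 := num (u @ [b])))"
      using c1[of "num u"] c2[of "num u"] by (simp add: num_snoc digit_def)
    then have 1: "run (Cond i (\<lambda>s. s = Some True) c2 c1) (regs w a (Z(0 := num u)))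
        (regs w a (Z(0 := num (u @ [b]))))"
      by (intro run_Cond) (simp add: hd rexD split: if_splits)
    have "(regs w a (Z(0 := num (u @ [b]))))(i := tl (regs w a (Z(0 := num (u @ [b]))) i)) =
        regs (w(i := v)) a (Z(0 := num (u @ [b])))"
      using i Cons.prems by (auto simp: regs_def fun_eq_iff)
    with run_pop[of i "regs w a (Z(0 := num (u @ [b])))"]
    have 2: "run (pop i) (regs w a (Z(0 := num (u @ [b])))) (regs (w(i := v)) a (Z(0 := num (u @ [b]))))"
      by simp
    have nz: "regs w a (Z(0 := num u)) i \<noteq> []" by (simp add: hd)
    show ?case
      using run_while_Cons[OF nz run_Seq[OF 1 2] Cons.IH[of "w(i := v)" "u @ [b]", OF fun_upd_same]]
      by (simp only: fun_upd_upd append.assoc append_Cons append_Nil)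
  qed
  then show ?thesis by blast
qed

lemma regs_upd: "i < a \<Longrightarrow> (regs w a e)(i := x) = regs (w(i := x)) a e"
  by (auto simp: regs_def fun_eq_iff)

lemma regs_lt: "i < a \<Longrightarrow> regs w a e i = w i"
  by (simp add: regs_def)

text \<open>Digits come off lowest first, and pushing each of them in front restores the order. A
  nonzero code is even exactly if its last digit is 2, that is, if the last letter is
  \<open>True\<close>.\<close>

lemma run_write_output:
  assumes i: "i < a"
    and par: "\<And>x. rex (Suc a) cp (Z(0 := x)) (Z(0 := x mod 2))"
    and half: "\<And>x. rex a ch (Z(0 := x)) (Z(0 := (x - 1) div 2))"
  shows "run (wh a 0 (Seq (dup a) (Seq cp (Seq (ifz a 1 (push i True) (push i False)) (Seq (clr a 1) ch)))))
    (regs w a (Z(0 := num v))) (regs (w(i := v @ w i)) a (Z(0 := 0)))"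
proof (induction v arbitrary: w rule: rev_induct)
  case Nil
  have "(Z(0 := 0)) 0 = 0" by simp
  then show ?case using rexD[OF rex_wh_0[of "Z(0 := 0)" 0]]
    by (simp only: num_Nil append_Nil fun_upd_triv)
next
  case (snoc b v)
  let ?x = "num (v @ [b])"
  have 1: "run (dup a) (regs w a (Z(0 := ?x))) (regs w a (Z(0 := ?x, 1 := ?x)))"
    by (rule rexD[OF rex_dup])
  have 2: "run cp (regs w a (Z(0 := ?x, 1 := ?x))) (regs w a (Z(0 := ?x, 1 := ?x mod 2)))"
    by (rule rexD[OF rex_shift[OF par]])
  let ?w = "w(i := b # w i)"
  have "run (push i b) (regs w a (Z(0 := ?x, 1 := ?x mod 2))) (regs ?w a (Z(0 := ?x, 1 := ?x mod 2)))"
    using run_push[of i b "regs w a (Z(0 := ?x, 1 := ?x mod 2))"] i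
    by (simp only: regs_upd regs_lt)
  then have 3: "run (ifz a 1 (push i True) (push i False)) (regs w a (Z(0 := ?x, 1 := ?x mod 2)))
      (regs ?w a (Z(0 := ?x, 1 := ?x mod 2)))"
    unfolding ifz_def by (intro run_Cond) (cases b; simp add: regs_def num_snoc digit_def)
  have 4: "run (clr a 1) (regs ?w a (Z(0 := ?x, 1 := ?x mod 2))) (regs ?w a (Z(0 := ?x)))"
    by (rule rexD, rule rex_eq[OF rex_clr]) (auto simp: fun_eq_iff)
  have "(?x - 1) div 2 = num v" by (simp add: num_snoc digit_def)
  then have 5: "run ch (regs ?w a (Z(0 := ?x))) (regs ?w a (Z(0 := num v)))"
    using rexD[OF half[of ?x], of ?w] by simp
  have nz: "regs w a (Z(0 := ?x)) (a + 0) \<noteq> []" by (simp add: regs_def num_snoc digit_def)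
  show ?case
    using run_while_Cons[OF nz run_Seq[OF 1 run_Seq[OF 2 run_Seq[OF 3 run_Seq[OF 4 5]]]]
      snoc.IH[of ?w, unfolded wh_def]]
    by (simp only: wh_def fun_upd_upd fun_upd_same append.assoc append_Cons append_Nil)
qed

text \<open>This is the one loop without an a priori bound, so nothing is claimed unless the search
  succeeds. Register 1 holds the truth value of \<open>\<not> D\<close>.\<close>

lemma search_com:
  assumes D: "decidable D" and s: "computable s"
  shows "\<exists>c. \<forall>x n. (\<forall>k<n. \<not> D ((s ^^ k) x)) \<longrightarrow> D ((s ^^ n) x) \<longrightarrow>
    rex a c (Z(0 := x)) (Z(0 := (s ^^ n) x))"
proof -
  have "decidable (\<lambda>x. \<not> D x)" by (intro computable_intros D)
  then obtain ct where t: "rex (Suc a) ct (Z(0 := x)) (Z(0 := of_bool (\<not> D x)))" for x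
    unfolding computable_def by blast
  obtain cs where s: "rex a cs (Z(0 := x)) (Z(0 := s x))" for x
    using s unfolding computable_def by blast
  let ?d = "Seq (clr a 1) (Seq cs (Seq (dup a) ct))"
  let ?e = "\<lambda>x. Z(0 := x, 1 := of_bool (\<not> D x))"
  have dt: "rex a (Seq (dup a) ct) (Z(0 := x)) (?e x)" for x
    by (rule rex_Seq[OF rex_dup rex_shift[OF t]])
  have d: "rex a ?d (?e x) (?e (s x))" for x
  proof (rule rex_Seq[OF _ rex_Seq[OF s dt]])
    show "rex a (clr a 1) (?e x) (Z(0 := x))"
      by (rule rex_eq[OF rex_clr]) (auto simp: fun_eq_iff)
  qed
  have loop: "rex a (wh a 1 ?d) (?e x) (Z(0 := (s ^^ n) x))"
    if "\<forall>k<n. \<not> D ((s ^^ k) x)" "D ((s ^^ n) x)" for x n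
    using that
  proof (induction n arbitrary: x)
    case 0
    then show ?case by (intro rex_eq[OF rex_wh_0]) (auto simp: fun_eq_iff)
  next
    case (Suc n)
    have nD: "\<not> D x" using Suc.prems(1)[rule_format, of 0] by simp
    have "rex a (wh a 1 ?d) (?e (s x)) (Z(0 := (s ^^ n) (s x)))"
    proof (rule Suc.IH)
      show "\<forall>k<n. \<not> D ((s ^^ k) (s x))"
      proof (intro allI impI)
        fix k assume "k < n"
        then show "\<not> D ((s ^^ k) (s x))"
          using Suc.prems(1)[rule_format, of "Suc k"] by (simp add: funpow_swap1)
      qed
      show "D ((s ^^ n) (s x))" using Suc.prems(2) by (simp add: funpow_swap1)
    qed
    moreover have "?e x 1 \<noteq> 0" using nD by simp
    ultimately show ?case using rex_wh_Suc[OF _ d] by (simp only: funpow_Suc_right o_apply)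
  qed
  show ?thesis by (intro exI allI impI) (rule rex_Seq[OF dt loop])
qed

theorem search_machine:
  assumes D: "decidable D" and g: "computable g"
  shows "\<exists>M. turing_machine M \<and> (\<forall>p v w e.
    (\<forall>e'<e. \<not> D (pr (pr (num p) (num v)) e')) \<longrightarrow> D (pr (pr (num p) (num v)) e) \<longrightarrow>
    g (pr (pr (num p) (num v)) e) = num w \<longrightarrow> tm_computes M p v w)"
proof -
  have c1: "computable (\<lambda>x. 2 * x + 1)" and c2: "computable (\<lambda>x. 2 * x + 2)"
    and s: "computable (\<lambda>z. pr (fs z) (Suc (sn z)))" and i: "computable (\<lambda>z. pr z 0)"
    and par: "computable (\<lambda>x. x mod 2)" and half: "computable (\<lambda>x. (x - 1) div 2)"
    by (intro computable_intros; simp)+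
  obtain r1 r2 where r: "rex 3 r1 (Z(0 := x)) (Z(0 := 2 * x + 1))" "rex 3 r2 (Z(0 := x)) (Z(0 := 2 * x + 2))" for x
    using c1 c2 unfolding computable_def by meson
  \<comment> \<open>The condition is read by programs at offset 4, so that tape 3, which already
    holds the code of the program, counts as frame.\<close>
  obtain q1 q2 where q: "rex 4 q1 (Z(0 := x)) (Z(0 := 2 * x + 1))" "rex 4 q2 (Z(0 := x)) (Z(0 := 2 * x + 2))" for x
    using c1 c2 unfolding computable_def by meson
  obtain cpr where cpr: "rex 3 cpr (Z(0 := x, 1 := y)) (Z(0 := pr x y))" for x y
    using computable2_pr unfolding computable2_def by blast
  obtain ci where ci: "rex 3 ci (Z(0 := x)) (Z(0 := pr x 0))" for x
    using i unfolding computable_def by blast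
  obtain cl where cl: "(\<forall>k<n. \<not> D (((\<lambda>z. pr (fs z) (Suc (sn z))) ^^ k) x)) \<Longrightarrow>
      D (((\<lambda>z. pr (fs z) (Suc (sn z))) ^^ n) x) \<Longrightarrow>
      rex 3 cl (Z(0 := x)) (Z(0 := ((\<lambda>z. pr (fs z) (Suc (sn z))) ^^ n) x))" for x n
    using search_com[OF D s, of 3] by blast
  have it: "((\<lambda>z. pr (fs z) (Suc (sn z))) ^^ n) (pr x 0) = pr x n" for n x
    by (induction n) simp_all
  obtain cg where cg: "rex 3 cg (Z(0 := x)) (Z(0 := g x))" for x
    using g unfolding computable_def by blast
  obtain cp where cp: "rex 4 cp (Z(0 := x)) (Z(0 := x mod 2))" for x
    using par unfolding computable_def by blast
  obtain ch where ch: "rex 3 ch (Z(0 := x)) (Z(0 := (x - 1) div 2))" for x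
    using half unfolding computable_def by blast
  define rd where "rd = (\<lambda>i c1 c2. while_stk i (Seq (Cond i (\<lambda>s. s = Some True) c2 c1) (pop i)))"
  define out where "out = wh 3 0 (Seq (dup 3) (Seq cp
      (Seq (ifz 3 1 (push 2 True) (push 2 False)) (Seq (clr 3 1) ch))))"
  define c where "c = Seq (rd 0 r1 r2) (Seq (rd 1 q1 q2) (Seq cpr (Seq ci (Seq cl (Seq cg out)))))"
  have run: "run c (\<lambda>i. if i = 0 then p else if i = 1 then v else [])
      (regs ((\<lambda>_. [])(2 := w)) 3 (Z(0 := 0)))"
    if e: "\<forall>e'<e. \<not> D (pr (pr (num p) (num v)) e')" "D (pr (pr (num p) (num v)) e)"
      "g (pr (pr (num p) (num v)) e) = num w" for p v w e
  proof -
    define w0 where "w0 = (\<lambda>i::nat. if i = 0 then p else if i = 1 then v else [])"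
    let ?w1 = "w0(0 := [])"
    let ?w2 = "\<lambda>_::nat. [] :: bool list"
    have w0: "w0 = regs w0 3 (Z(0 := num []))"
      by (auto simp: w0_def regs_def fun_eq_iff)
    have 1: "run (rd 0 r1 r2) w0 (regs ?w1 3 (Z(0 := num p)))"
      using run_read_tape[OF r, of 0 w0 "[]"] w0 unfolding rd_def by (simp add: w0_def)
    have 2: "regs ?w1 3 (Z(0 := num p)) = regs (regs ?w1 3 (Z(0 := num p))) 4 (Z(0 := num []))"
      by (auto simp: w0_def regs_def fun_eq_iff)
    have 3: "regs ((regs ?w1 3 (Z(0 := num p)))(1 := [])) 4 (Z(0 := num v)) =
        regs ?w2 3 (Z(0 := num p, 1 := num v))"
      by (auto simp: w0_def regs_def fun_eq_iff)
    have "regs ?w1 3 (Z(0 := num p)) 1 = v" by (simp add: w0_def regs_def)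
    then have 4: "run (rd 1 q1 q2) (regs ?w1 3 (Z(0 := num p))) (regs ?w2 3 (Z(0 := num p, 1 := num v)))"
      using run_read_tape[OF q, of 1 "regs ?w1 3 (Z(0 := num p))" "[]"] 2 3 unfolding rd_def by simp
    have 5: "rex 3 cl (Z(0 := pr (pr (num p) (num v)) 0)) (Z(0 := pr (pr (num p) (num v)) e))"
      using cl[of e "pr (pr (num p) (num v)) 0"] e(1,2) by (simp add: it)
    have 6: "run cpr (regs ?w2 3 (Z(0 := num p, 1 := num v))) (regs ?w2 3 (Z(0 := pr (num p) (num v))))"
      by (rule rexD[OF cpr])
    have 7: "run ci (regs ?w2 3 (Z(0 := pr (num p) (num v)))) (regs ?w2 3 (Z(0 := pr (pr (num p) (num v)) 0)))"
      by (rule rexD[OF ci])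
    have 8: "run cg (regs ?w2 3 (Z(0 := pr (pr (num p) (num v)) e))) (regs ?w2 3 (Z(0 := num w)))"
      using rexD[OF cg[of "pr (pr (num p) (num v)) e"], of ?w2] e(3) by simp
    have 9: "run out (regs ?w2 3 (Z(0 := num w))) (regs (?w2(2 := w)) 3 (Z(0 := 0)))"
      using run_write_output[of 2 3 cp ch ?w2 w] cp ch unfolding out_def by simp
    show ?thesis
      unfolding c_def w0_def[symmetric]
      by (rule run_Seq[OF 1 run_Seq[OF 4 run_Seq[OF 6 run_Seq[OF 7 run_Seq[OF rexD[OF 5] run_Seq[OF 8 9]]]]]])
  qed
  obtain M where M: "turing_machine M"
    "\<And>p v w S. exec c (init_store p v) S \<Longrightarrow> snd (S 2) = cell (map Some w) \<Longrightarrow> tm_computes M p v w"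
    using compile_com[of c] by blast
  have "tm_computes M p v w"
    if e: "\<forall>e'<e. \<not> D (pr (pr (num p) (num v)) e')" "D (pr (pr (num p) (num v)) e)"
      "g (pr (pr (num p) (num v)) e) = num w" for p v w e
  proof (rule M(2))
    show "exec c (init_store p v) (stk (regs ((\<lambda>_. [])(2 := w)) 3 (Z(0 := 0))))"
      using run[OF e] by (simp add: run_def init_store_stk)
    show "snd (stk (regs ((\<lambda>_. [])(2 := w)) 3 (Z(0 := 0))) 2) = cell (map Some w)"
      by (simp add: stk_def regs_def)
  qed
  with M(1) show ?thesis by blast
qed

section \<open>Descriptions from enumerations\<close>

lemma halted_stable:
  assumes "tm_halted M ((tm_step M ^^ N) c)" "N \<le> N'"
  shows "(tm_step M ^^ N') c = (tm_step M ^^ N) c"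
proof -
  have "tm_step M ((tm_step M ^^ N) c) = (tm_step M ^^ N) c"
    using assms(1) by (simp add: tm_halted_def tm_step_def)
  then have "(tm_step M ^^ (N' - N)) ((tm_step M ^^ N) c) = (tm_step M ^^ N) c"
    by (rule funpow_fixed)
  then show ?thesis using assms(2) by (metis comp_apply funpow_add le_add_diff_inverse2)
qed

lemma tm_computes_unique:
  assumes "tm_computes M p v u" "tm_computes M p v u'"
  shows "u = u'"
proof -
  obtain t t' where "tm_halted M ((tm_step M ^^ t) (tm_init M p v))"
    "tm_output ((tm_step M ^^ t) (tm_init M p v)) = u"
    "tm_halted M ((tm_step M ^^ t') (tm_init M p v))"
    "tm_output ((tm_step M ^^ t') (tm_init M p v)) = u'"
    using assms unfolding tm_computes_def by blast
  then show ?thesis using halted_stable[of M t _ t'] halted_stable[of M t' _ t] by (metis nat_le_linear)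
qed

lemma computes_haltn:
  assumes "turing_machine M" "tm_computes M p v u"
  shows "\<exists>N0. \<forall>N\<ge>N0. haltn M (num p) (num v) N \<and> outn M (num p) (num v) N = num u"
proof -
  obtain t where "tm_halted M ((tm_step M ^^ t) (tm_init M p v))"
    "tm_output ((tm_step M ^^ t) (tm_init M p v)) = u"
    using assms(2) unfolding tm_computes_def by blast
  then show ?thesis using simulation[OF assms(1)] halted_stable by metis
qed

lemma haltn_computes:
  assumes "turing_machine M" "haltn M (num p) (num v) N"
  shows "\<exists>u. tm_computes M p v u \<and> outn M (num p) (num v) N = num u"
  using assms simulation[OF assms(1)] unfolding tm_computes_def by blast

lemma Kcond_le: "tm_computes U p v u \<Longrightarrow> Kcond U u v \<le> length p"
  unfolding Kcond_def by (rule Least_le) blast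

lemma universal_search:
  assumes U: "universal_tm U" and D: "decidable D" and g: "computable g"
  shows "\<exists>c. \<forall>p v w e. (\<forall>e'<e. \<not> D (pr (pr (num p) (num v)) e')) \<longrightarrow> D (pr (pr (num p) (num v)) e) \<longrightarrow>
    g (pr (pr (num p) (num v)) e) = num w \<longrightarrow> (\<exists>p'. length p' \<le> length p + c \<and> tm_computes U p' v w)"
proof -
  obtain M where M: "turing_machine M" "\<And>p v w e.
    (\<forall>e'<e. \<not> D (pr (pr (num p) (num v)) e')) \<Longrightarrow> D (pr (pr (num p) (num v)) e) \<Longrightarrow>
    g (pr (pr (num p) (num v)) e) = num w \<Longrightarrow> tm_computes M p v w"
    using search_machine[OF D g] by blast
  obtain c where "\<And>p v u. tm_computes M p v u \<Longrightarrow> \<exists>p'. length p' \<le> length p + c \<and> tm_computes U p' v u"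
    using U M(1) unfolding universal_tm_def by blast
  then show ?thesis using M(2) by blast
qed

text \<open>A machine that stops its search at once and copies its program to the output shows that
  descriptions exist, so the \<open>LEAST\<close> is attained.\<close>

lemma Kcond_program:
  assumes U: "universal_tm U"
  shows "\<exists>p. length p = Kcond U u v \<and> tm_computes U p v u"
proof -
  have "decidable (\<lambda>_. True)" "computable (\<lambda>z. fs (fs z))" by (intro computable_intros)+
  from universal_search[OF U this]
  obtain c where "\<forall>p v w e. (\<forall>e'<e. \<not> True) \<longrightarrow> True \<longrightarrow> fs (fs (pr (pr (num p) (num v)) e)) = num w \<longrightarrow>
    (\<exists>p'. length p' \<le> length p + c \<and> tm_computes U p' v w)" by (elim exE)
  from this[rule_format, of 0 u v u] have "\<exists>p'. tm_computes U p' v u" by auto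
  then have "\<exists>k p. length p = k \<and> tm_computes U p v u" by blast
  from LeastI_ex[OF this] show ?thesis unfolding Kcond_def .
qed

section \<open>Self-delimiting codes for tuples\<close>

definition catn :: "nat \<Rightarrow> nat \<Rightarrow> nat" where
  "catn u v = u * 2 ^ len v + v"

lemma catn [simp]: "catn (num u) (num v) = num (u @ v)"
  by (simp add: catn_def num_append)

lemma computable_catn [computable_intros]: "computable f \<Longrightarrow> computable g \<Longrightarrow> computable (\<lambda>x. catn (f x) (g x))"
  unfolding catn_def by (intro computable_intros)

definition onesn :: "nat \<Rightarrow> nat" where
  "onesn k = 2 ^ Suc k - 2"

lemma onesn [simp]: "onesn k = num (replicate k True)"
proof (induction k)
  case (Suc k)
  have "(1::nat) \<le> 2 ^ k" by simp
  then have "onesn (Suc k) = 2 * onesn k + 2" unfolding onesn_def power_Suc by arith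
  also have "\<dots> = num (replicate k True @ [True])" by (simp add: Suc num_snoc digit_def)
  finally show ?case by (simp add: replicate_append_same)
qed (simp add: onesn_def)

lemma computable_ones [computable_intros]:
  assumes "computable f" shows "computable (\<lambda>x. num (replicate (f x) True))"
proof -
  have "computable onesn" unfolding onesn_def by (intro computable_intros)
  from computable_comp[OF this assms] show ?thesis by simp
qed

definition ones :: "nat \<Rightarrow> bool list" where
  "ones k = replicate k True @ [False]"

text \<open>The unary blocks, each closed by \<open>False\<close>, announce \<open>h\<close> and the
  lengths of \<open>a\<close> and \<open>b\<close>. The last component needs no delimiter, so its
  length is a free piece of information: it transmits \<open>r\<close>.\<close>

definition enc :: "nat \<Rightarrow> bool list \<Rightarrow> bool list \<Rightarrow> bool list \<Rightarrow> bool list" where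
  "enc h a b i = ones h @ ones (length a) @ ones (length b) @ a @ b @ i"

lemma ones_append_inj: "ones k @ u = ones k' @ u' \<longleftrightarrow> k = k' \<and> u = u'"
proof (induction k arbitrary: k')
  case 0
  then show ?case by (cases k') (auto simp: ones_def)
next
  case (Suc k)
  then show ?case by (cases k') (auto simp: ones_def)
qed

lemma enc_inj: "enc h a b i = enc h' a' b' i' \<longleftrightarrow> h = h' \<and> a = a' \<and> b = b' \<and> i = i'"
  by (auto simp: enc_def ones_append_inj)

lemma length_enc: "length (enc h a b i) = h + 2 * length a + 2 * length b + 3 + length i"
  by (simp add: enc_def ones_def)

definition encn :: "nat \<Rightarrow> nat \<Rightarrow> nat \<Rightarrow> nat \<Rightarrow> nat" where
  "encn h a b i = (let o1 = \<lambda>k. catn (num (replicate k True)) 1 in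
     catn (o1 h) (catn (o1 (len a)) (catn (o1 (len b)) (catn a (catn b i)))))"

lemma encn [simp]: "encn h (num a) (num b) (num i) = num (enc h a b i)"
proof -
  have "catn (num (replicate k True)) 1 = num (ones k)" for k
    using catn[of "replicate k True" "[False]"] by (simp add: ones_def num_def digit_def)
  then show ?thesis by (simp add: encn_def enc_def)
qed

lemma computable_encn [computable_intros]: "computable h \<Longrightarrow> computable a \<Longrightarrow> computable b \<Longrightarrow> computable i \<Longrightarrow>
    computable (\<lambda>x. encn (h x) (a x) (b x) (i x))"
  unfolding encn_def Let_def by (intro computable_intros)

text \<open>Decoding becomes a bounded search because every component is at most the code of the
  whole word.\<close>

lemma num_le_enc: "h \<le> num (enc h a b i)" "num a \<le> num (enc h a b i)"
  "num b \<le> num (enc h a b i)" "num i \<le> num (enc h a b i)"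
proof -
  have r: "num v \<le> num (u @ v)" "num u \<le> num (u @ v)" for u v
    by (simp_all add: num_append trans_le_add1)
  show "num i \<le> num (enc h a b i)" "num b \<le> num (enc h a b i)" "num a \<le> num (enc h a b i)"
    unfolding enc_def by (meson r order_trans)+
  show "h \<le> num (enc h a b i)"
    using length_le_num[of "enc h a b i"] by (simp add: length_enc)
qed

text \<open>Indices are padded to exactly \<open>r\<close> bits, since the length of the index has
  to carry \<open>r\<close>.\<close>

lemma bval_index:
  assumes "j < 2 ^ r"
  shows "\<exists>i. length i = r \<and> bval (num i) = j"
proof -
  obtain i where i: "num i = j + 2 ^ r - 1" using num_surj by blast
  then have S: "Suc (num i) = j + 2 ^ r" by simp
  have "(2::nat) ^ length i < 2 ^ Suc r" "(2::nat) ^ r < 2 ^ Suc (length i)"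
    using num_bounds[of i] assms unfolding S by auto
  then have "length i = r" by (simp add: power_strict_increasing_iff del: power_Suc)
  then show ?thesis using S by (intro exI[of _ i]) (simp add: bval_def)
qed

text \<open>Listing each element only at the first stage where it appears bounds its rank by the
  number of elements.\<close>

definition first :: "(nat \<Rightarrow> nat \<Rightarrow> bool) \<Rightarrow> nat \<Rightarrow> bool" where
  "first E e \<longleftrightarrow> E (fs e) (sn e) \<and> (\<forall>N<fs e. \<not> E N (sn e))"

text \<open>An event \<open>e\<close> pairs a stage with an element. Different first events concern
  different elements, so \<open>sn\<close> is injective on them; counting \<open>e\<close> itself
  makes the bound strict, as an index of \<open>r\<close> bits requires.\<close>

lemma first_rank:
  assumes fin: "finite {u. \<exists>N. E N u}" and u: "\<exists>N. E N u"
  shows "\<exists>e. sn e = u \<and> first E e \<and> (\<Sum>e'<e. of_bool (first E e')) < card {u. \<exists>N. E N u}"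
proof -
  define N where "N = (LEAST N. E N u)"
  define e where "e = pr N u"
  have "\<not> E N' u" if "N' < N" for N'
    using not_less_Least[of N' "\<lambda>N. E N u"] that unfolding N_def by blast
  moreover have "E N u" unfolding N_def by (rule LeastI_ex[OF u])
  ultimately have e: "first E e" by (simp add: first_def e_def)
  let ?A = "{e'. e' \<le> e \<and> first E e'}"
  have "inj_on sn ?A"
  proof (rule inj_onI)
    fix d d' assume "d \<in> ?A" "d' \<in> ?A" and s: "sn d = sn d'"
    then have f: "first E d" "first E d'" by simp_all
    have "\<not> fs d < fs d'" "\<not> fs d' < fs d" using f unfolding first_def s by blast+
    then have "fs d = fs d'" by simp
    then show "d = d'" using s by (metis pr_fs_sn)
  qed
  then have "card ?A \<le> card {u. \<exists>N. E N u}"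
    by (rule card_inj_on_le) (use fin in \<open>auto simp: first_def\<close>)
  moreover have "?A = insert e ({..<e} \<inter> {e'. first E e'})"
    using e by auto
  then have "card ?A = Suc (\<Sum>e'<e. of_bool (first E e'))" by simp
  ultimately have "(\<Sum>e'<e. of_bool (first E e')) < card {u. \<exists>N. E N u}"
    by (simp only: Suc_le_eq)
  then show ?thesis using e by (intro exI[of _ e] conjI) (simp_all only: e_def sn_pr)
qed

text \<open>The decoder searches for the first-appearance event whose rank is the transmitted index.
  \<open>E\<close> only has to be decidable stage by stage, while \<open>W\<close> is merely
  enumerable; the parameters are handed to \<open>E\<close>, so that one machine and one constant
  serve all of them.\<close>

lemma enumeration_description:
  assumes U: "universal_tm U"
    and E: "decidable (\<lambda>z. E (fs (fs z)) (sn (fs z)) (fs (sn z)) (sn (sn z)))"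
  shows "\<exists>c. \<forall>h a b r v u. let W = {u. \<exists>N. E (pr h (pr (num a) (pr (num b) r))) (num v) N u} in
    finite W \<longrightarrow> card W \<le> 2 ^ r \<longrightarrow> num u \<in> W \<longrightarrow>
    Kcond U u v \<le> h + 2 * length a + 2 * length b + r + c"
proof -
  define par where "par = (\<lambda>h a b i. pr h (pr a (pr b (len i))))"
  define D where "D = (\<lambda>z. \<exists>h < Suc (fs (fs z)). \<exists>a < Suc (fs (fs z)). \<exists>b < Suc (fs (fs z)). \<exists>i < Suc (fs (fs z)).
     fs (fs z) = encn h a b i \<and> first (E (par h a b i) (sn (fs z))) (sn z) \<and>
     (\<Sum>e<sn z. of_bool (first (E (par h a b i) (sn (fs z))) e)) = bval i)"
  have F: "decidable (\<lambda>x. first (E (q x) (v x)) (e x))" if "computable q" "computable v" "computable e" for q v e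
  proof -
    have E': "decidable (\<lambda>x. E (q x) (v x) (N x) (u x))" if "computable q" "computable v" "computable N" "computable u" for q v N u
      using computable_comp[OF E, of "\<lambda>x. pr (pr (q x) (v x)) (pr (N x) (u x))"] that by (simp add: computable_intros)
    show ?thesis unfolding first_def by (intro computable_intros E' computable_comp[OF that(1)] computable_comp[OF that(2)] computable_comp[OF that(3)] that)
  qed
  have "decidable D"
    unfolding D_def par_def by (intro computable_intros F)
  moreover have "computable (\<lambda>z. sn (sn z))" by (intro computable_intros)
  ultimately obtain c where c: "\<And>p v w e. (\<forall>e'<e. \<not> D (pr (pr (num p) (num v)) e')) \<Longrightarrow>
      D (pr (pr (num p) (num v)) e) \<Longrightarrow> sn (sn (pr (pr (num p) (num v)) e)) = num w \<Longrightarrow>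
      \<exists>p'. length p' \<le> length p + c \<and> tm_computes U p' v w"
    using universal_search[OF U] by blast
  \<comment> \<open>The 3 pays for the closing letters of the three unary blocks.\<close>
  have "Kcond U u v \<le> h + 2 * length a + 2 * length b + r + (c + 3)"
    if W: "W = {u. \<exists>N. E (pr h (pr (num a) (pr (num b) r))) (num v) N u}"
      and fin: "finite W" "card W \<le> 2 ^ r" "num u \<in> W" for h a b r v u W
  proof -
    define q where "q = pr h (pr (num a) (pr (num b) r))"
    let ?f = "first (E q (num v))"
    obtain e where e: "sn e = num u" "?f e" "(\<Sum>e'<e. of_bool (?f e')) < card W"
      using first_rank[of "E q (num v)" "num u"] fin unfolding W q_def by auto
    obtain i where i: "length i = r" "bval (num i) = (\<Sum>e'<e. of_bool (?f e'))"
      using bval_index[of "\<Sum>e'<e. of_bool (?f e')" r] e(3) fin(2) by auto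
    define p where "p = enc h a b i"
    have D: "D (pr (pr (num p) (num v)) d) \<longleftrightarrow> ?f d \<and> (\<Sum>e'<d. of_bool (?f e')) = bval (num i)" for d
    proof
      assume "D (pr (pr (num p) (num v)) d)"
      then obtain h' a' b' i' where *: "num p = encn h' a' b' i'"
        "first (E (par h' a' b' i') (num v)) d"
        "(\<Sum>e'<d. of_bool (first (E (par h' a' b' i') (num v)) e')) = bval i'"
        unfolding D_def by auto
      obtain as bs "is" where s: "a' = num as" "b' = num bs" "i' = num is" using num_surj by metis
      have "h' = h \<and> as = a \<and> bs = b \<and> is = i" using *(1) by (simp add: s p_def num_inj enc_inj)
      then show "?f d \<and> (\<Sum>e'<d. of_bool (?f e')) = bval (num i)"
        using *(2,3) by (simp add: s par_def q_def i(1))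
    next
      assume *: "?f d \<and> (\<Sum>e'<d. of_bool (?f e')) = bval (num i)"
      show "D (pr (pr (num p) (num v)) d)"
        unfolding D_def fs_pr sn_pr using num_le_enc[where h = h and a = a and b = b and i = i] *
        by (intro exI[of _ h] exI[of _ "num a"] exI[of _ "num b"] exI[of _ "num i"] conjI)
          (simp_all add: p_def less_Suc_eq_le par_def q_def i(1))
    qed
    \<comment> \<open>Ranks increase strictly along first events, so \<open>e\<close> is the least
      number satisfying \<open>D\<close> and the search cannot stop earlier.\<close>
    have less: "(\<Sum>e'<d. of_bool (?f e') :: nat) < (\<Sum>e'<e. of_bool (?f e'))" if "?f d" "d < e" for d
    proof -
      have "(\<Sum>e'<Suc d. of_bool (?f e') :: nat) \<le> (\<Sum>e'<e. of_bool (?f e'))"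
        by (rule sum_mono2) (use \<open>d < e\<close> in auto)
      then show ?thesis using \<open>?f d\<close> by simp
    qed
    have "\<exists>p'. length p' \<le> length p + c \<and> tm_computes U p' v u"
    proof (rule c[of e])
      show "\<forall>e'<e. \<not> D (pr (pr (num p) (num v)) e')"
      proof (intro allI impI)
        fix d assume "d < e"
        then show "\<not> D (pr (pr (num p) (num v)) d)" using less[of d] by (simp only: D i(2)) auto
      qed
      show "D (pr (pr (num p) (num v)) e)" using e i(2) by (simp add: D)
      show "sn (sn (pr (pr (num p) (num v)) e)) = num u" using e(1) by simp
    qed
    then obtain p' where "length p' \<le> length p + c" "tm_computes U p' v u" by blast
    then show ?thesis using Kcond_le[of U p' v u] i(1) by (simp add: p_def length_enc)
  qed
  then show ?thesis unfolding Let_def by blast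
qed

section \<open>Symmetry of information\<close>

text \<open>The codes below \<open>2 ^ T - 1\<close> are exactly those of programs shorter than
  \<open>T\<close>. Fixing the number \<open>N\<close> of steps makes the condition
  decidable.\<close>

definition short :: "tm \<Rightarrow> nat \<Rightarrow> nat \<Rightarrow> nat \<Rightarrow> nat \<Rightarrow> bool" where
  "short U T v N w \<longleftrightarrow> (\<exists>p<2 ^ T - 1. haltn U p v N \<and> outn U p v N = w)"

lemma computable_short [computable_intros]:
  assumes "computable T" "computable v" "computable N" "computable w"
  shows "decidable (\<lambda>x. short U (T x) (v x) (N x) (w x))"
  unfolding short_def
  by (intro computable_intros assms assms[THEN computable_comp])

text \<open>The threshold T of the overview, with k and l read from the outputs of the programs
  \<open>a\<close> and \<open>b\<close> after \<open>N\<close> steps. The condition 0 is the code of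
  the empty string.\<close>

definition thr :: "tm \<Rightarrow> nat \<Rightarrow> nat \<Rightarrow> nat \<Rightarrow> nat \<Rightarrow> nat \<Rightarrow> nat" where
  "thr U h a b v N = bval (outn U a v N) + bval (outn U b 0 N) - 4 * h"

lemma computable_thr [computable_intros]:
  "computable h \<Longrightarrow> computable a \<Longrightarrow> computable b \<Longrightarrow> computable v \<Longrightarrow> computable N \<Longrightarrow>
    computable (\<lambda>x. thr U (h x) (a x) (b x) (v x) (N x))"
  unfolding thr_def by (intro computable_intros)

definition shorts :: "tm \<Rightarrow> nat \<Rightarrow> bool list \<Rightarrow> bool list set" where
  "shorts U T v = {w. \<exists>p. length p < T \<and> tm_computes U p v w}"

lemma num_less_iff: "num p < 2 ^ T - 1 \<longleftrightarrow> length p < T"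
proof
  assume "num p < 2 ^ T - 1"
  then have "(2::nat) ^ length p < 2 ^ T" using num_bounds(1)[of p] by linarith
  then show "length p < T" by (simp add: power_strict_increasing_iff)
next
  assume "length p < T"
  then have "2 ^ Suc (length p) \<le> (2::nat) ^ T" by (intro power_increasing) auto
  then show "num p < 2 ^ T - 1" using num_bounds(2)[of p] by linarith
qed

lemma short_shorts:
  assumes "turing_machine U" "short U T (num v) N (num w)"
  shows "w \<in> shorts U T v"
proof -
  obtain p where p: "p < 2 ^ T - 1" "haltn U p (num v) N" "outn U p (num v) N = num w"
    using assms(2) unfolding short_def by blast
  obtain s where s: "p = num s" using num_surj by metis
  obtain u where "tm_computes U s v u" "outn U p (num v) N = num u"
    using haltn_computes[OF assms(1)] p(2) s by blast
  moreover have "length s < T" using p(1) unfolding s num_less_iff .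
  ultimately show ?thesis using p(3) by (auto simp: shorts_def num_inj)
qed

lemma shorts_short:
  assumes "turing_machine U" "w \<in> shorts U T v"
  shows "\<exists>N0. \<forall>N\<ge>N0. short U T (num v) N (num w)"
proof -
  obtain p where p: "length p < T" "tm_computes U p v w"
    using assms(2) unfolding shorts_def by blast
  then show ?thesis
    using computes_haltn[OF assms(1) p(2)] num_less_iff unfolding short_def by blast
qed

lemma shorts_card: "finite (shorts U T v)" "card (shorts U T v) < 2 ^ T"
proof -
  let ?f = "\<lambda>c. THE w. \<exists>p. num p = c \<and> tm_computes U p v w"
  have "shorts U T v \<subseteq> ?f ` {..<2 ^ T - 1}"
  proof
    fix w assume "w \<in> shorts U T v"
    then obtain p where p: "length p < T" "tm_computes U p v w" unfolding shorts_def by blast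
    have "?f (num p) = w"
      by (rule the_equality) (use p tm_computes_unique in \<open>auto simp: num_inj\<close>)
    then show "w \<in> ?f ` {..<2 ^ T - 1}" using p(1) num_less_iff by blast
  qed
  then show "finite (shorts U T v)" and "card (shorts U T v) < 2 ^ T"
    using surj_card_le[of "{..<2 ^ T - 1 :: nat}" "shorts U T v" ?f]
    by (auto intro: finite_subset le_less_trans)
qed

definition sect :: "tm \<Rightarrow> nat \<Rightarrow> nat \<Rightarrow> bool list \<Rightarrow> bool list set" where
  "sect U T n u = {v. length v = n \<and> u @ v \<in> shorts U T (bin_rep n)}"

lemma finite_length: "finite {u :: bool list. length u = n}"
  using finite_lists_length_eq[of "UNIV :: bool set" n] by simp

lemma finite_sect: "finite (sect U T n u)"
  by (rule finite_subset[OF _ finite_length[of n]]) (auto simp: sect_def)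

text \<open>Double counting: all \<open>u\<close> have the same length, so concatenation is
  injective and the sections embed disjointly into \<open>shorts\<close>, which has fewer than
  \<open>2 ^ T\<close> elements.\<close>

lemma large_sections:
  assumes m: "2 ^ m \<le> card (sect U T n x)"
  shows "m \<le> T" "card {u. length u = n \<and> 2 ^ m \<le> card (sect U T n u)} \<le> 2 ^ (T - m)"
proof -
  let ?Q = "{u. length u = n \<and> 2 ^ m \<le> card (sect U T n u)}"
  have fQ: "finite ?Q" by (rule finite_subset[OF _ finite_length[of n]]) auto
  have "card (sect U T n x) \<le> card (shorts U T (bin_rep n))"
    by (rule card_inj_on_le[of "\<lambda>v. x @ v"]) (auto simp: sect_def shorts_card inj_on_def)
  then have "(2::nat) ^ m < 2 ^ T" using m shorts_card(2)[of U T "bin_rep n"] by linarith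
  then show mT: "m \<le> T" by (simp add: power_strict_increasing_iff)
  have "card ?Q * 2 ^ m \<le> (\<Sum>u\<in>?Q. card (sect U T n u))"
    using sum_mono[of ?Q "\<lambda>_. 2 ^ m" "\<lambda>u. card (sect U T n u)"] by simp
  also have "\<dots> = card (SIGMA u:?Q. sect U T n u)"
    using fQ finite_sect by simp
  also have "\<dots> \<le> card (shorts U T (bin_rep n))"
    by (rule card_inj_on_le[of "\<lambda>(u, v). u @ v"]) (auto simp: sect_def shorts_card inj_on_def)
  also have "\<dots> < 2 ^ T" by (rule shorts_card)
  also have "\<dots> = 2 ^ (T - m) * 2 ^ m" using mT by (simp flip: power_add)
  finally have "card ?Q * 2 ^ m < 2 ^ (T - m) * 2 ^ m" .
  then show "card ?Q \<le> 2 ^ (T - m)" by (metis less_imp_le mult_less_cancel2)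
qed

text \<open>Before both programs have halted, \<open>thr\<close> is computed from unfinished outputs
  and could admit too many strings. The enumerations below therefore demand both halting conditions,
  which hold at all late stages.\<close>

lemma thr_eq:
  assumes U: "turing_machine U"
    and a: "tm_computes U a v (bin_rep k)" and b: "tm_computes U b [] (bin_rep l)"
  shows "haltn U (num a) (num v) N \<Longrightarrow> haltn U (num b) 0 N \<Longrightarrow>
      thr U h (num a) (num b) (num v) N = k + l - 4 * h"
    and "\<exists>N0. \<forall>N\<ge>N0. haltn U (num a) (num v) N \<and> haltn U (num b) 0 N"
proof -
  show "thr U h (num a) (num b) (num v) N = k + l - 4 * h"
    if H: "haltn U (num a) (num v) N" "haltn U (num b) 0 N"
  proof -
    obtain u w where u: "tm_computes U a v u" "outn U (num a) (num v) N = num u"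
      and w: "tm_computes U b [] w" "outn U (num b) 0 N = num w"
      using haltn_computes[OF U H(1)] haltn_computes[OF U, of b "[]" N] H(2) by auto
    have "u = bin_rep k" "w = bin_rep l" using tm_computes_unique u(1) w(1) a b by blast+
    then show ?thesis using u(2) w(2) by (simp add: thr_def)
  qed
  obtain N1 where "\<forall>N\<ge>N1. haltn U (num a) (num v) N" using computes_haltn[OF U a] by blast
  moreover obtain N2 where "\<forall>N\<ge>N2. haltn U (num b) 0 N" using computes_haltn[OF U b] by auto
  ultimately show "\<exists>N0. \<forall>N\<ge>N0. haltn U (num a) (num v) N \<and> haltn U (num b) 0 N"
    by (intro exI[of _ "max N1 N2"]) simp
qed

text \<open>The set enumerated under the condition \<open>x\<close> is the section at
  \<open>x\<close>, so its size alone determines how long the index of \<open>y\<close> must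
  be.\<close>

lemma describe_second:
  assumes U: "universal_tm U"
  shows "\<exists>c. \<forall>h a b k l n x y r. length x = n \<longrightarrow> tm_computes U a (bin_rep n) (bin_rep k) \<longrightarrow>
    tm_computes U b [] (bin_rep l) \<longrightarrow> y \<in> sect U (k + l - 4 * h) n x \<longrightarrow>
    card (sect U (k + l - 4 * h) n x) \<le> 2 ^ r \<longrightarrow>
    Kcond U y x \<le> h + 2 * length a + 2 * length b + r + c"
proof -
  have tm: "turing_machine U" using U by (simp add: universal_tm_def)
  \<comment> \<open>The condition is now \<open>x\<close> itself;
    \<open>num (bin_rep (len v))\<close> recovers the condition under which \<open>a\<close> and the
    short programs run.\<close>
  define E where "E = (\<lambda>q v N u. haltn U (fs (sn q)) (num (bin_rep (len v))) N \<and>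
    haltn U (fs (sn (sn q))) 0 N \<and> len u = len v \<and>
    short U (thr U (fs q) (fs (sn q)) (fs (sn (sn q))) (num (bin_rep (len v))) N)
      (num (bin_rep (len v))) N (catn v u))"
  have "decidable (\<lambda>z. E (fs (fs z)) (sn (fs z)) (fs (sn z)) (sn (sn z)))"
    unfolding E_def by (intro computable_intros)
  from enumeration_description[OF U this] obtain c where
    c: "finite W \<Longrightarrow> card W \<le> 2 ^ r \<Longrightarrow> num u \<in> W \<Longrightarrow> Kcond U u v \<le> h + 2 * length a + 2 * length b + r + c"
    if "W = {u. \<exists>N. E (pr h (pr (num a) (pr (num b) r))) (num v) N u}" for h a b r v u W
    unfolding Let_def by blast
  have "Kcond U y x \<le> h + 2 * length a + 2 * length b + r + c"
    if x: "length x = n" and a: "tm_computes U a (bin_rep n) (bin_rep k)"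
      and b: "tm_computes U b [] (bin_rep l)" and y: "y \<in> sect U (k + l - 4 * h) n x"
      and r: "card (sect U (k + l - 4 * h) n x) \<le> 2 ^ r"
    for h a b k l n x y r
  proof -
    let ?q = "pr h (pr (num a) (pr (num b) r))"
    let ?T = "k + l - 4 * h"
    have E: "E ?q (num x) N (num u) \<longleftrightarrow> haltn U (num a) (num (bin_rep n)) N \<and> haltn U (num b) 0 N \<and>
        length u = n \<and> short U ?T (num (bin_rep n)) N (num (x @ u))" for N u
      using thr_eq(1)[OF tm a b, of N h] by (auto simp: E_def x)
    define W where "W = {u. \<exists>N. E ?q (num x) N u}"
    have "W \<subseteq> num ` sect U ?T n x"
    proof
      fix w assume "w \<in> W"
      then obtain N where N: "E ?q (num x) N w" unfolding W_def by blast
      obtain u where u: "w = num u" using num_surj by metis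
      then show "w \<in> num ` sect U ?T n x"
        using N E short_shorts[OF tm] by (auto simp: sect_def)
    qed
    then have "finite W" "card W \<le> card (sect U ?T n x)"
      by (rule finite_subset[OF _ finite_imageI[OF finite_sect]], rule surj_card_le[OF finite_sect])
    moreover have "num y \<in> W"
    proof -
      obtain N1 where N1: "\<forall>N\<ge>N1. haltn U (num a) (num (bin_rep n)) N \<and> haltn U (num b) 0 N"
        using thr_eq(2)[OF tm a b] by blast
      obtain N2 where N2: "\<forall>N\<ge>N2. short U ?T (num (bin_rep n)) N (num (x @ y))"
        using shorts_short[OF tm, of "x @ y" ?T "bin_rep n"] y by (auto simp: sect_def)
      have "E ?q (num x) (max N1 N2) (num y)"
        using N1 N2 y by (auto simp: E sect_def)
      then show ?thesis unfolding W_def by blast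
    qed
    ultimately show ?thesis using c[OF W_def] r by simp
  qed
  then show ?thesis by blast
qed

text \<open>The strings with a large section are few by \<open>large_sections\<close>, and a section
  is recognized as large once enough of its elements have appeared. Having \<open>m\<close> on the
  left avoids truncated subtraction.\<close>

lemma describe_first:
  assumes U: "universal_tm U"
  shows "\<exists>c. \<forall>h a b k l n x m. length x = n \<longrightarrow> tm_computes U a (bin_rep n) (bin_rep k) \<longrightarrow>
    tm_computes U b [] (bin_rep l) \<longrightarrow> 2 ^ m \<le> card (sect U (k + l - 4 * h) n x) \<longrightarrow>
    Kcond U x (bin_rep n) + m \<le> h + 2 * length a + 2 * length b + (k + l - 4 * h) + c"
proof -
  have tm: "turing_machine U" using U by (simp add: universal_tm_def)
  define T where "T = (\<lambda>q v N. thr U (fs q) (fs (sn q)) (fs (sn (sn q))) v N)"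
  \<comment> \<open>The last parameter is \<open>r = T - m\<close>, so the exponent on the left is
    \<open>m\<close>. Words of length \<open>n\<close> have codes below \<open>2 ^ Suc n\<close>,
    which bounds the sum.\<close>
  define E where "E = (\<lambda>q v N u. haltn U (fs (sn q)) v N \<and> haltn U (fs (sn (sn q))) 0 N \<and> len u = bval v \<and>
    (2::nat) ^ (T q v N - sn (sn (sn q))) \<le>
      (\<Sum>y<2 ^ Suc (bval v). of_bool (len y = bval v \<and> short U (T q v N) v N (catn u y))))"
  have "decidable (\<lambda>z. E (fs (fs z)) (sn (fs z)) (fs (sn z)) (sn (sn z)))"
    unfolding E_def T_def by (intro computable_intros)
  from enumeration_description[OF U this] obtain c where
    c: "finite W \<Longrightarrow> card W \<le> 2 ^ r \<Longrightarrow> num u \<in> W \<Longrightarrow> Kcond U u v \<le> h + 2 * length a + 2 * length b + r + c"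
    if "W = {u. \<exists>N. E (pr h (pr (num a) (pr (num b) r))) (num v) N u}" for h a b r v u W
    unfolding Let_def by blast
  have "Kcond U x (bin_rep n) + m \<le> h + 2 * length a + 2 * length b + (k + l - 4 * h) + c"
    if x: "length x = n" and a: "tm_computes U a (bin_rep n) (bin_rep k)"
      and b: "tm_computes U b [] (bin_rep l)" and m: "2 ^ m \<le> card (sect U (k + l - 4 * h) n x)"
    for h a b k l n x m
  proof -
    define t where "t = k + l - 4 * h"
    let ?v = "bin_rep n"
    let ?Q = "{u. length u = n \<and> 2 ^ m \<le> card (sect U t n u)}"
    define r where "r = t - m"
    have mT: "m \<le> t" and Q: "card ?Q \<le> 2 ^ r"
      using large_sections[OF m] by (simp_all add: r_def t_def)
    have fQ: "finite ?Q" by (rule finite_subset[OF _ finite_length[of n]]) auto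
    let ?q = "pr h (pr (num a) (pr (num b) r))"
    let ?B = "\<lambda>N u. {y. length y = n \<and> short U t (num ?v) N (num (u @ y))}"
    have B: "(\<Sum>y<2 ^ Suc n. of_bool (len y = n \<and> short U t (num ?v) N (catn (num u) y))) = card (?B N u)"
      for N u
    proof -
      have "num ` ?B N u = {..<2 ^ Suc n} \<inter> {y. len y = n \<and> short U t (num ?v) N (catn (num u) y)}"
        (is "_ = ?R")
      proof
        show "num ` ?B N u \<subseteq> ?R"
          using num_bounds(2) by (auto dest: Suc_lessD)
        show "?R \<subseteq> num ` ?B N u"
        proof
          fix y assume y: "y \<in> ?R"
          obtain s where "y = num s" using num_surj by metis
          then show "y \<in> num ` ?B N u" using y by auto
        qed
      qed
      moreover have "card (num ` ?B N u) = card (?B N u)"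
        by (rule card_image) (auto simp: inj_on_def num_inj)
      ultimately show ?thesis by simp
    qed
    have E: "E ?q (num ?v) N (num u) \<longleftrightarrow> haltn U (num a) (num ?v) N \<and> haltn U (num b) 0 N \<and>
        length u = n \<and> 2 ^ m \<le> card (?B N u)" for N u
    proof -
      have "t - r = m" using mT by (simp add: r_def)
      then show ?thesis
        using thr_eq(1)[OF tm a b, of N h, folded t_def] B[of N u] by (auto simp: E_def T_def)
    qed
    define W where "W = {u. \<exists>N. E ?q (num ?v) N u}"
    have "W \<subseteq> num ` ?Q"
    proof
      fix w assume "w \<in> W"
      then obtain N where N: "E ?q (num ?v) N w" unfolding W_def by blast
      obtain u where u: "w = num u" using num_surj by metis
      have "card (?B N u) \<le> card (sect U t n u)"
        by (rule card_mono[OF finite_sect]) (use short_shorts[OF tm] in \<open>auto simp: sect_def\<close>)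
      then show "w \<in> num ` ?Q" using N u by (auto simp: E)
    qed
    then have "finite W" "card W \<le> card ?Q"
      by (rule finite_subset[OF _ finite_imageI[OF fQ]], rule surj_card_le[OF fQ])
    moreover have "num x \<in> W"
    proof -
      obtain N1 where N1: "\<forall>N\<ge>N1. haltn U (num a) (num ?v) N \<and> haltn U (num b) 0 N"
        using thr_eq(2)[OF tm a b] by blast
      have "\<forall>y\<in>sect U t n x. \<exists>N0. \<forall>N\<ge>N0. short U t (num ?v) N (num (x @ y))"
        using shorts_short[OF tm] by (auto simp: sect_def)
      then obtain f where f: "\<forall>y\<in>sect U t n x. \<forall>N\<ge>f y. short U t (num ?v) N (num (x @ y))"
        by metis
      \<comment> \<open>The section is finite, so there is one stage at which both programs have
        halted and all of its elements have appeared.\<close>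
      define N where "N = Max (insert N1 (f ` sect U t n x))"
      have N: "N1 \<le> N" "\<And>y. y \<in> sect U t n x \<Longrightarrow> f y \<le> N"
        unfolding N_def using finite_sect[of U t n x] by auto
      have "sect U t n x \<subseteq> ?B N x" using f N(2) by (auto simp: sect_def)
      then have "card (sect U t n x) \<le> card (?B N x)"
        by (rule card_mono[rotated]) (rule finite_subset[OF _ finite_length[of n]], auto)
      then have "E ?q (num ?v) N (num x)" using N1 N(1) m x by (simp add: E t_def)
      then show ?thesis unfolding W_def by blast
    qed
    ultimately have "Kcond U x ?v \<le> h + 2 * length a + 2 * length b + r + c"
      using c[OF W_def] Q by simp
    then show ?thesis using mT by (simp add: r_def t_def)
  qed
  then show ?thesis by blast
qed

lemma symmetry_of_information:
  assumes U: "universal_tm U"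
  shows "\<exists>C. \<forall>n x y. length x = n \<longrightarrow> length y = n \<longrightarrow>
    Kcond_nat U x n + Kcond U y x \<le> Kcond_nat U (x @ y) n + C * Suc (K2_nat U x n + K2 U y x)"
proof -
  obtain c1 where c1: "Kcond U y x \<le> h + 2 * length a + 2 * length b + r + c1"
    if "length x = n" "tm_computes U a (bin_rep n) (bin_rep k)" "tm_computes U b [] (bin_rep l)"
      "y \<in> sect U (k + l - 4 * h) n x" "card (sect U (k + l - 4 * h) n x) \<le> 2 ^ r"
    for h a b k l n x y r
    using describe_second[OF U] by metis
  obtain c2 where c2: "Kcond U x (bin_rep n) + m \<le> h + 2 * length a + 2 * length b + (k + l - 4 * h) + c2"
    if "length x = n" "tm_computes U a (bin_rep n) (bin_rep k)" "tm_computes U b [] (bin_rep l)"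
      "2 ^ m \<le> card (sect U (k + l - 4 * h) n x)"
    for h a b k l n x m
    using describe_first[OF U] by metis
  have "Kcond_nat U x n + Kcond U y x \<le>
      Kcond_nat U (x @ y) n + (8 + 2 * c1 + 2 * c2) * Suc (K2_nat U x n + K2 U y x)"
    if x: "length x = n" and y: "length y = n" for n x y
  proof -
    define k l t where klt: "k = Kcond_nat U x n" "l = Kcond U y x" "t = Kcond_nat U (x @ y) n"
    obtain a where a: "length a = K2_nat U x n" "tm_computes U a (bin_rep n) (bin_rep k)"
      using Kcond_program[OF U, of "bin_rep k" "bin_rep n"] by (auto simp: K2_nat_def Kcond_nat_def klt)
    obtain b where b: "length b = K2 U y x" "tm_computes U b [] (bin_rep l)"
      using Kcond_program[OF U, of "bin_rep l" "[]"] by (auto simp: K2_def klt)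
    define s where "s = length a + length b"
    have "k + l \<le> t + (8 + 2 * c1 + 2 * c2) * Suc s"
    proof (cases "k + l \<le> t")
      case False
      \<comment> \<open>The largest \<open>h\<close> for which \<open>T\<close> still exceeds
        \<open>t\<close>: the 1 is subtracted because programs must be strictly shorter than
        \<open>T\<close>. Conversely \<open>k + l - t\<close> is at most
        \<open>4 * h + 4\<close>.\<close>
      define h where "h = (k + l - t - 1) div 4"
      define T where "T = k + l - 4 * h"
      have h: "4 * h \<le> k + l - t - 1" "k + l - t - 1 < 4 * h + 4" unfolding h_def by auto
      have "t < T" using h(1) False by (simp add: T_def)
      obtain p where p: "length p = t" "tm_computes U p (bin_rep n) (x @ y)"
        using Kcond_program[OF U, of "x @ y" "bin_rep n"] by (auto simp: klt Kcond_nat_def)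
      then have ys: "y \<in> sect U T n x" using y \<open>t < T\<close> by (auto simp: sect_def shorts_def)
      obtain r where r: "card (sect U T n x) \<le> 2 ^ r" "\<And>r'. r' < r \<Longrightarrow> \<not> card (sect U T n x) \<le> 2 ^ r'"
        using exists_least_iff[of "\<lambda>r. card (sect U T n x) \<le> 2 ^ r"] less_exp[of "card (sect U T n x)"]
        by (metis less_imp_le)
      \<comment> \<open>Minimality of \<open>r\<close> encloses the size of the section between two
        consecutive powers of 2. For \<open>r = 0\<close> the truncated exponent is 0, and
        \<open>y\<close> shows that the section is nonempty.\<close>
      have m: "2 ^ (r - 1) \<le> card (sect U T n x)"
      proof (cases r)
        case 0
        have "card (sect U T n x) \<noteq> 0" using ys finite_sect by auto
        then show ?thesis using 0 by simp
      next
        case (Suc r')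
        then show ?thesis using r(2)[of r'] by simp
      qed
      have "l \<le> h + 2 * s + r + c1"
        using c1[OF x a(2) b(2), of y h r] ys r(1) by (simp add: T_def s_def klt)
      moreover have "k + (r - 1) \<le> h + 2 * s + T + c2"
        using c2[OF x a(2) b(2), of "r - 1" h] m by (simp add: T_def s_def klt Kcond_nat_def)
      \<comment> \<open>In the sum of the two bounds \<open>r\<close> cancels up to 1 and
        \<open>k + l\<close> cancels against \<open>T\<close>, leaving \<open>4 * h\<close> against
        the \<open>2 * h\<close> paid for transmission.\<close>
      ultimately have "2 * h \<le> 4 * s + 1 + c1 + c2" using h(1) unfolding T_def by linarith
      then have "k + l - t \<le> 8 * s + 6 + 2 * c1 + 2 * c2" using h(2) by linarith
      also have "\<dots> \<le> (8 + 2 * c1 + 2 * c2) * Suc s" by (simp add: algebra_simps)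
      finally show ?thesis using False by linarith
    qed simp
    then show ?thesis by (simp add: klt s_def a(1) b(1))
  qed
  then show ?thesis by blast
qed

theorem theorem3:
  fixes U :: tm
  assumes "universal_tm U"
  shows "\<exists>c\<^sub>0 c\<^sub>1 :: real. 0 \<le> c\<^sub>0 \<and> 0 \<le> c\<^sub>1 \<and>
    (\<forall>(n :: nat) (x :: bool list) (y :: bool list).
       length x = n \<longrightarrow> length y = n \<longrightarrow>
       real (Kcond_nat U x n) \<ge> 13 * log 2 (real n) + real_of_int (mutual_info U x y) + c\<^sub>0 \<longrightarrow>
       real (Kcond_nat U y n) \<ge> 7 * log 2 (real n) + real_of_int (mutual_info U x y) + c\<^sub>0 \<longrightarrow>
       real (Kcond_nat U (x @ y) n) \<ge>
         real (Kcond_nat U x n) + real (Kcond U y x) - log_info (mutual_info U x y)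
         - c\<^sub>1 * real (K2_nat U x n + K2_nat U y n + K2 U y x))"
proof -
  obtain C where C: "Kcond_nat U x n + Kcond U y x \<le> Kcond_nat U (x @ y) n + C * Suc (K2_nat U x n + K2 U y x)"
    if "length x = n" "length y = n" for n x y
    using symmetry_of_information[OF assms] by blast
  \<comment> \<open>The number, if any, whose binary representation is printed by the empty program
    under the empty condition. If there is none, the value is arbitrary and the next claim holds
    vacuously.\<close>
  define l0 where "l0 = (THE l. tm_computes U [] [] (bin_rep l))"
  have l0: "l = l0" if "tm_computes U [] [] (bin_rep l)" for l
  proof -
    have "(THE l. tm_computes U [] [] (bin_rep l)) = l"
    proof (rule the_equality, rule that)
      fix l' assume "tm_computes U [] [] (bin_rep l')"
      then have "bin_rep l' = bin_rep l" using that by (rule tm_computes_unique)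
      then show "l' = l" by (metis bval_bin_rep)
    qed
    then show ?thesis by (simp add: l0_def)
  qed
  have "real (Kcond_nat U (x @ y) n) \<ge>
         real (Kcond_nat U x n) + real (Kcond U y x) - log_info (mutual_info U x y)
         - real (2 * C) * real (K2_nat U x n + K2_nat U y n + K2 U y x)"
    if x: "length x = n" and y: "length y = n"
      and h: "real (Kcond_nat U y n) \<ge> 7 * log 2 (real n) + real_of_int (mutual_info U x y) + real (Suc l0)"
    for n x y
  proof -
    \<comment> \<open>For \<open>n = 0\<close> the logarithm has the default value 0.\<close>
    have "0 \<le> log 2 (real n)" by (cases "n = 0") (simp_all add: log_def)
    \<comment> \<open>With this identity C(y|n) cancels from the hypothesis, which becomes a lower
      bound on C(y|x); \<open>Suc l0\<close> makes it exceed \<open>l0\<close> strictly.\<close>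
    moreover have "real_of_int (mutual_info U x y) = real (Kcond_nat U y n) - real (Kcond U y x)"
      by (simp add: mutual_info_def x)
    ultimately have "real l0 < real (Kcond U y x)" using h by simp
    then have "Kcond U y x \<noteq> l0" by simp
    then have "K2 U y x \<noteq> 0"
      using l0 Kcond_program[OF assms, of "bin_rep (Kcond U y x)" "[]"] unfolding K2_def
      by (metis length_0_conv)
    \<comment> \<open>The sum of the second-order complexities is at least 1, so doubling it covers
      the successor; this gives the constant \<open>2 * C\<close>.\<close>
    then have "Suc (K2_nat U x n + K2 U y x) \<le> 2 * (K2_nat U x n + K2_nat U y n + K2 U y x)" by simp
    then have "C * Suc (K2_nat U x n + K2 U y x) \<le> 2 * C * (K2_nat U x n + K2_nat U y n + K2 U y x)"
      using mult_le_mono2[of _ _ C] by (metis mult.assoc mult.commute)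
    then have "Kcond_nat U x n + Kcond U y x \<le>
        Kcond_nat U (x @ y) n + 2 * C * (K2_nat U x n + K2_nat U y n + K2 U y x)"
      using C[OF x y] by linarith
    then have "real (Kcond_nat U x n + Kcond U y x) \<le>
        real (Kcond_nat U (x @ y) n + 2 * C * (K2_nat U x n + K2_nat U y n + K2 U y x))"
      by (rule of_nat_mono)
    moreover have "0 \<le> log_info (mutual_info U x y)" by (simp add: log_info_def)
    ultimately show ?thesis by simp
  qed
  then show ?thesis by (intro exI[of _ "real (Suc l0)"] exI[of _ "real (2 * C)"]) auto
qed

end
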